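(* Let $p\geq 2$ be an integer. Suppose that $\mathbf{v}_1,\ldots,\mathbf{v}_p \in \mathbb{C}^n$ are vectors and $\sigma \in S_{2p}$ is a permutation. Then \[ \big\|R_{\sigma}\big(T(\mathbf{v}_1\mathbf{v}_1^*\otimes \cdots \otimes \mathbf{v}_p\mathbf{v}_p^* )\big)\big\|_{\mathrm{tr}} \leq \prod_{j=1}^p \|\mathbf{v}_j\|^2. \]
   Context: $\mathcal{M}_n(\mathbb{C})$ is the set of complex $n\times n$ matrices; $\otimes$ is the Kronecker product, so $(\mathcal{M}_n(\mathbb{C}))^{\otimes p}$ is identified with the $n^p\times n^p$ complex matrices. Vectors are columns, $^*$ denotes the conjugate transpose and $^T$ the (unconjugated) transpose. $\|\cdot\|$ is the Euclidean norm on $\mathbb{C}^n$ and $\|A\|_{\mathrm{tr}}=\mathrm{tr}(\sqrt{A^*A})$ is the trace norm (sum of singular values). $S_{2p}$ is the group of permutations of $\{1,\ldots,2p\}$. For $\sigma\in S_{2p}$, the realignment map $R_\sigma : (\mathcal{M}_n(\mathbb{C}))^{\otimes p} \to (\mathcal{M}_n(\mathbb{C}))^{\otimes p}$ is the linear map determined by \[ R_\sigma\big(\mathbf{u}_1\mathbf{u}_{p+1}^T \otimes \mathbf{u}_2\mathbf{u}_{p+2}^T \otimes \cdots \otimes \mathbf{u}_p\mathbf{u}_{2p}^T\big) = \mathbf{u}_{\sigma(1)}\mathbf{u}_{\sigma(p+1)}^T \otimes \mathbf{u}_{\sigma(2)}\mathbf{u}_{\sigma(p+2)}^T \otimes \cdots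 \otimes \mathbf{u}_{\sigma(p)}\mathbf{u}_{\sigma(2p)}^T \] for all $\mathbf{u}_1,\ldots,\mathbf{u}_{2p}\in\mathbb{C}^n$. The local diagonal unitary twirl $T:(\mathcal{M}_n(\mathbb{C}))^{\otimes p} \to (\mathcal{M}_n(\mathbb{C}))^{\otimes p}$ is \[ T(X) = \int_U (U^{\otimes p})X(U^{\otimes p})^* \, \mathrm{d}U, \] where the integration is with respect to the normalized Haar (probability) measure on the group of diagonal unitary matrices $U\in\mathcal{M}_n(\mathbb{C})$. Equivalently, writing $\mathbf{e}_1,\ldots,\mathbf{e}_n$ for the standard basis of $\mathbb{C}^n$ and $[X]_{(i_1,j_1),\ldots,(i_p,j_p)} = (\mathbf{e}_{i_1}\otimes \cdots \otimes \mathbf{e}_{i_p})^* X(\mathbf{e}_{j_1}\otimes \cdots \otimes \mathbf{e}_{j_p})$, the entry $[T(X)]_{(i_1,j_1),\ldots,(i_p,j_p)}$ equals $[X]_{(i_1,j_1),\ldots,(i_p,j_p)}$ if $\{i_1,\ldots,i_p\}=\{j_1,\ldots,j_p\}$ as multisets, and equals $0$ otherwise. *)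

theory Defs
  imports
    "HOL-Probability.Probability"
    "HOL-Combinatorics.Permutations"
    "Jordan_Normal_Form.Schur_Decomposition"
begin

unbundle no vec_syntax
notation Matrix.vec_index (infixl "$" 100)

section \<open>Vectors, Kronecker products and the trace norm\<close>

definition vec_norm2 :: "complex Matrix.vec \<Rightarrow> real" where
  "vec_norm2 v = sqrt (\<Sum>i<dim_vec v. (cmod (v $ i))\<^sup>2)"

text \<open>\<open>outer u w\<close> is $u w^T$, without conjugation; hence $v v^*$ is \<open>outer v (conjugate v)\<close>.\<close>

definition outer :: "complex Matrix.vec \<Rightarrow> complex Matrix.vec \<Rightarrow> complex Matrix.mat" where
  "outer u w = Matrix.mat (dim_vec u) (dim_vec w) (\<lambda>(i, j). u $ i * w $ j)"

definition kron :: "complex Matrix.mat \<Rightarrow> complex Matrix.mat \<Rightarrow> complex Matrix.mat" where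
  "kron A B = Matrix.mat (dim_row A * dim_row B) (dim_col A * dim_col B)
     (\<lambda>(i, j). A $$ (i div dim_row B, j div dim_col B) * B $$ (i mod dim_row B, j mod dim_col B))"

text \<open>\<open>kron_prod p A\<close> is $A_1 \otimes \cdots \otimes A_p$; factors are numbered from 1.\<close>

primrec kron_prod :: "nat \<Rightarrow> (nat \<Rightarrow> complex Matrix.mat) \<Rightarrow> complex Matrix.mat" where
  "kron_prod 0 A = 1\<^sub>m 1"
| "kron_prod (Suc p) A = kron (kron_prod p A) (A (Suc p))"

definition mat_trace :: "complex Matrix.mat \<Rightarrow> complex" where
  "mat_trace A = (\<Sum>i<dim_row A. A $$ (i, i))"

text \<open>In \<open>(B *\<^sub>v x) \<bullet>c x\<close> the second argument is conjugated, so this is $x^* B x$.\<close>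

definition pos_semidef :: "nat \<Rightarrow> complex Matrix.mat \<Rightarrow> bool" where
  "pos_semidef n B \<longleftrightarrow> B \<in> carrier_mat n n \<and> mat_adjoint B = B \<and>
     (\<forall>x \<in> carrier_vec n. 0 \<le> Re ((B *\<^sub>v x) \<bullet>c x))"

definition psd_sqrt :: "complex Matrix.mat \<Rightarrow> complex Matrix.mat" where
  "psd_sqrt M = (THE B. pos_semidef (dim_row M) B \<and> B * B = M)"

text \<open>The trace of a Hermitian matrix is real, so \<open>Re\<close> only adjusts the type.\<close>

definition trace_norm :: "complex Matrix.mat \<Rightarrow> real" where
  "trace_norm A = Re (mat_trace (psd_sqrt (mat_adjoint A * A)))"

section \<open>The local diagonal unitary twirl\<close>

text \<open>The group of diagonal unitary matrices is the torus of all \<open>mat_diag n z\<close> with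
  $|z_0| = \cdots = |z_{n-1}| = 1$. Its normalized Haar measure is the product of the
  rotation-invariant probability measures on the unit circle. The lemmas
  \<open>prob_space_torus_haar\<close> and \<open>torus_haar_invariant\<close> below confirm normalization and invariance.\<close>

definition circle_haar :: "complex measure" where
  "circle_haar = distr (uniform_measure lborel {0..<2 * pi}) borel cis"

definition torus_haar :: "nat \<Rightarrow> (nat \<Rightarrow> complex) measure" where
  "torus_haar n = PiM {..<n} (\<lambda>_. circle_haar)"

text \<open>The matrix-valued integral is taken entrywise.\<close>

definition twirl :: "nat \<Rightarrow> nat \<Rightarrow> complex Matrix.mat \<Rightarrow> complex Matrix.mat" where
  "twirl n p X = Matrix.mat (n ^ p) (n ^ p) (\<lambda>(i, j).
     \<integral>z. (let W = kron_prod p (\<lambda>_. mat_diag n z) in W * X * mat_adjoint W) $$ (i, j) \<partial>torus_haar n)"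

section \<open>Realignment maps\<close>

definition is_realignment ::
  "nat \<Rightarrow> nat \<Rightarrow> (nat \<Rightarrow> nat) \<Rightarrow> (complex Matrix.mat \<Rightarrow> complex Matrix.mat) \<Rightarrow> bool" where
  "is_realignment n p \<sigma> R \<longleftrightarrow>
     R \<in> carrier_mat (n ^ p) (n ^ p) \<rightarrow> carrier_mat (n ^ p) (n ^ p) \<and>
     (\<forall>X \<in> carrier_mat (n ^ p) (n ^ p). \<forall>Y \<in> carrier_mat (n ^ p) (n ^ p). R (X + Y) = R X + R Y) \<and>
     (\<forall>c. \<forall>X \<in> carrier_mat (n ^ p) (n ^ p). R (c \<cdot>\<^sub>m X) = c \<cdot>\<^sub>m R X) \<and>
     (\<forall>u. (\<forall>k \<in> {1..2 * p}. u k \<in> carrier_vec n) \<longrightarrow>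
        R (kron_prod p (\<lambda>k. outer (u k) (u (p + k)))) =
        kron_prod p (\<lambda>k. outer (u (\<sigma> k)) (u (\<sigma> (p + k)))))"

text \<open>Extensionality only fixes the irrelevant values outside the $n^p \times n^p$ matrices, so that
  the description is unique; see \<open>realign_exists_unique\<close> and \<open>realign_is_realignment\<close> below.\<close>

definition realign :: "nat \<Rightarrow> nat \<Rightarrow> (nat \<Rightarrow> nat) \<Rightarrow> complex Matrix.mat \<Rightarrow> complex Matrix.mat" where
  "realign n p \<sigma> = (THE R. R \<in> extensional (carrier_mat (n ^ p) (n ^ p)) \<and> is_realignment n p \<sigma> R)"

section \<open>Well-definedness of the realignment map\<close>

text \<open>\<open>dig n p k i\<close> is the $k$-th of the $p$ base-$n$ digits of \<open>i\<close>, most significant first.\<close>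

definition dig :: "nat \<Rightarrow> nat \<Rightarrow> nat \<Rightarrow> nat \<Rightarrow> nat" where
  "dig n p k i = (i div n ^ (p - k)) mod n"

primrec enc :: "nat \<Rightarrow> nat \<Rightarrow> (nat \<Rightarrow> nat) \<Rightarrow> nat" where
  "enc n 0 f = 0"
| "enc n (Suc p) f = enc n p f * n + f (Suc p)"

lemma dig_Suc: "k \<le> p \<Longrightarrow> dig n (Suc p) k i = dig n p k (i div n)"
  by (simp add: dig_def Suc_diff_le div_mult2_eq)

lemma dig_last: "dig n (Suc p) (Suc p) i = i mod n"
  by (simp add: dig_def)

lemma enc_less: "(\<And>k. k \<in> {1..p} \<Longrightarrow> f k < n) \<Longrightarrow> enc n p f < n ^ p"
proof (induction p)
  case (Suc p)
  have "enc n p f < n ^ p" by (rule Suc.IH) (auto intro: Suc.prems)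
  moreover have "f (Suc p) < n" by (rule Suc.prems) auto
  ultimately have "enc n p f * n + f (Suc p) < Suc (enc n p f) * n" "Suc (enc n p f) * n \<le> n ^ p * n"
    by (auto intro: mult_le_mono1 simp del: mult_Suc) simp
  then show ?case by (simp add: mult.commute)
qed simp

lemma dig_enc: "(\<And>k. k \<in> {1..p} \<Longrightarrow> f k < n) \<Longrightarrow> k \<in> {1..p} \<Longrightarrow> dig n p k (enc n p f) = f k"
proof (induction p)
  case (Suc p)
  have l: "f (Suc p) < n" by (rule Suc.prems) auto
  show ?case
  proof (cases "k = Suc p")
    case True with l show ?thesis by (simp add: dig_last)
  next
    case False
    with Suc.prems(2) have k: "k \<in> {1..p}" by auto
    have "dig n p k (enc n p f) = f k" by (rule Suc.IH) (use k Suc.prems(1) in auto)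
    with k l show ?thesis by (simp add: dig_Suc)
  qed
qed simp

lemma enc_cong: "(\<And>k. k \<in> {1..p} \<Longrightarrow> f k = g k) \<Longrightarrow> enc n p f = enc n p g"
  by (induction p) auto

lemma enc_dig: "i < n ^ p \<Longrightarrow> enc n p (\<lambda>k. dig n p k i) = i"
proof (induction p arbitrary: i)
  case (Suc p)
  have "i div n < n ^ p" using Suc.prems by (simp add: less_mult_imp_div_less mult.commute)
  moreover have "enc n p (\<lambda>k. dig n (Suc p) k i) = enc n p (\<lambda>k. dig n p k (i div n))"
    by (rule enc_cong) (simp add: dig_Suc)
  ultimately show ?case using Suc.IH[of "i div n"] by (simp add: dig_last)
qed simp

lemma dig_less: "i < n ^ p \<Longrightarrow> k \<in> {1..p} \<Longrightarrow> dig n p k i < n"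
  by (cases "n = 0"; cases "p = 0") (auto simp: dig_def power_0_left)

lemma dig_inj: "i < n ^ p \<Longrightarrow> j < n ^ p \<Longrightarrow> (\<And>k. k \<in> {1..p} \<Longrightarrow> dig n p k i = dig n p k j) \<Longrightarrow> i = j"
  using enc_cong[of p "\<lambda>k. dig n p k i" "\<lambda>k. dig n p k j" n] by (simp add: enc_dig)

lemma outer_carrier: "u \<in> carrier_vec n \<Longrightarrow> w \<in> carrier_vec m \<Longrightarrow> outer u w \<in> carrier_mat n m"
  by (auto simp: outer_def)

lemma kron_prod_carrier:
  "(\<And>k. k \<in> {1..p} \<Longrightarrow> A k \<in> carrier_mat n n) \<Longrightarrow> kron_prod p A \<in> carrier_mat (n ^ p) (n ^ p)"
proof (induction p)
  case (Suc p)
  have "kron_prod p A \<in> carrier_mat (n ^ p) (n ^ p)" by (rule Suc.IH) (auto intro: Suc.prems)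
  moreover have "A (Suc p) \<in> carrier_mat n n" by (rule Suc.prems) auto
  ultimately show ?case by (auto simp: kron_def mult.commute)
qed simp

lemma kron_prod_index:
  "(\<And>k. k \<in> {1..p} \<Longrightarrow> A k \<in> carrier_mat n n) \<Longrightarrow> i < n ^ p \<Longrightarrow> j < n ^ p \<Longrightarrow>
   kron_prod p A $$ (i, j) = (\<Prod>k = 1..p. A k $$ (dig n p k i, dig n p k j))"
proof (induction p arbitrary: i j)
  case (Suc p)
  have c: "kron_prod p A \<in> carrier_mat (n ^ p) (n ^ p)"
    by (rule kron_prod_carrier) (auto intro: Suc.prems)
  have a: "A (Suc p) \<in> carrier_mat n n" by (rule Suc.prems) auto
  have b: "i div n < n ^ p" "j div n < n ^ p"
    using Suc.prems by (simp_all add: less_mult_imp_div_less mult.commute)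
  have "kron_prod p A $$ (i div n, j div n) =
    (\<Prod>k = 1..p. A k $$ (dig n p k (i div n), dig n p k (j div n)))"
    by (rule Suc.IH[OF _ b]) (auto intro: Suc.prems)
  also have "\<dots> = (\<Prod>k = 1..p. A k $$ (dig n (Suc p) k i, dig n (Suc p) k j))"
    by (rule prod.cong) (auto simp: dig_Suc)
  finally show ?case using a c Suc.prems(2,3)
    by (simp add: kron_def dig_last mult.commute)
qed simp

definition multi_index :: "nat \<Rightarrow> nat \<Rightarrow> nat \<Rightarrow> nat \<Rightarrow> nat \<Rightarrow> nat" where
  "multi_index n p i j m = (if m \<le> p then dig n p m i else dig n p (m - p) j)"

definition realign_entries ::
  "nat \<Rightarrow> nat \<Rightarrow> (nat \<Rightarrow> nat) \<Rightarrow> complex Matrix.mat \<Rightarrow> complex Matrix.mat" where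
  "realign_entries n p \<sigma> X = Matrix.mat (n ^ p) (n ^ p) (\<lambda>(i, j).
     X $$ (enc n p (\<lambda>k. multi_index n p i j (inv_into UNIV \<sigma> k)),
           enc n p (\<lambda>k. multi_index n p i j (inv_into UNIV \<sigma> (p + k)))))"

lemma prod_split2: "(\<Prod>m = 1..2 * p. f m) = (\<Prod>k = 1..p. f k * f (p + k :: nat) :: complex)"
proof -
  have "(\<Prod>m = 1..2 * p. f m) = (\<Prod>m = 1..p. f m) * (\<Prod>m = p + 1..p + p. f m)"
    using prod.ub_add_nat[of 1 p f p] unfolding mult_2 by simp
  moreover have "(\<Prod>m = p + 1..p + p. f m) = (\<Prod>k = 1..p. f (p + k))"
    using prod.shift_bounds_cl_nat_ivl[of f 1 p p] by (simp add: add.commute)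
  ultimately show ?thesis by (simp add: prod.distrib)
qed

lemma permutes_double:
  fixes p k :: nat
  assumes "\<sigma> permutes {1..2 * p}" "k \<in> {1..p}"
  shows "\<sigma> k \<in> {1..2 * p}" "\<sigma> (p + k) \<in> {1..2 * p}"
  using permutes_in_image[OF assms(1)] assms(2) by auto

lemma multi_index_less:
  assumes "i < n ^ p" "j < n ^ p" "m \<in> {1..2 * p}"
  shows "multi_index n p i j m < n"
proof (cases "m \<le> p")
  case True
  then show ?thesis using assms dig_less[of i n p m] by (simp add: multi_index_def)
next
  case False
  then have "m - p \<in> {1..p}" using assms(3) by auto
  then show ?thesis using False assms dig_less[of j n p "m - p"] by (simp add: multi_index_def)
qed

lemma is_realignment_entries:
  assumes \<sigma>: "\<sigma> permutes {1..2 * p}"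
  shows "is_realignment n p \<sigma> (restrict (realign_entries n p \<sigma>) (carrier_mat (n ^ p) (n ^ p)))"
proof -
  have inv\<sigma>: "inv_into UNIV \<sigma> permutes {1..2 * p}" using \<sigma> by (rule permutes_inv)
  have lt: "enc n p (\<lambda>k. multi_index n p i j (inv_into UNIV \<sigma> k)) < n ^ p"
           "enc n p (\<lambda>k. multi_index n p i j (inv_into UNIV \<sigma> (p + k))) < n ^ p"
    if "i < n ^ p" "j < n ^ p" for i j
    by (auto intro!: enc_less multi_index_less[OF that] permutes_double[OF inv\<sigma>])
  have "realign_entries n p \<sigma> (kron_prod p (\<lambda>k. outer (u k) (u (p + k)))) =
        kron_prod p (\<lambda>k. outer (u (\<sigma> k)) (u (\<sigma> (p + k))))"
    if u: "\<forall>k \<in> {1..2 * p}. u k \<in> carrier_vec n" for u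
  proof -
    have c: "outer (u k) (u (p + k)) \<in> carrier_mat n n" if "k \<in> {1..p}" for k
      using u that by (intro outer_carrier) auto
    have c': "outer (u (\<sigma> k)) (u (\<sigma> (p + k))) \<in> carrier_mat n n" if "k \<in> {1..p}" for k
      using u permutes_double[OF \<sigma> that] by (intro outer_carrier) auto
    note C = kron_prod_carrier[of p "\<lambda>k. outer (u k) (u (p + k))", OF c]
    note C' = kron_prod_carrier[of p "\<lambda>k. outer (u (\<sigma> k)) (u (\<sigma> (p + k)))", OF c']
    show ?thesis
    proof (rule eq_matI)
      fix i j
      assume "i < dim_row (kron_prod p (\<lambda>k. outer (u (\<sigma> k)) (u (\<sigma> (p + k)))))"
        "j < dim_col (kron_prod p (\<lambda>k. outer (u (\<sigma> k)) (u (\<sigma> (p + k)))))"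
      then have ij: "i < n ^ p" "j < n ^ p" using C' by auto
      let ?w = "multi_index n p i j"
      have w1: "?w (inv_into UNIV \<sigma> k) < n" "?w (inv_into UNIV \<sigma> (p + k)) < n" if "k \<in> {1..p}" for k
        using that by (auto intro!: multi_index_less[OF ij] permutes_double[OF inv\<sigma>])
      have "realign_entries n p \<sigma> (kron_prod p (\<lambda>k. outer (u k) (u (p + k)))) $$ (i, j) =
        kron_prod p (\<lambda>k. outer (u k) (u (p + k))) $$
          (enc n p (\<lambda>k. ?w (inv_into UNIV \<sigma> k)), enc n p (\<lambda>k. ?w (inv_into UNIV \<sigma> (p + k))))"
        using ij by (simp add: realign_entries_def)
      also have "\<dots> = (\<Prod>k = 1..p. outer (u k) (u (p + k)) $$ (?w (inv_into UNIV \<sigma> k), ?w (inv_into UNIV \<sigma> (p + k))))"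
      proof (subst kron_prod_index[OF c lt[OF ij]], assumption, rule prod.cong[OF refl])
        fix k assume k: "k \<in> {1..p}"
        have "dig n p k (enc n p (\<lambda>k. ?w (inv_into UNIV \<sigma> k))) = ?w (inv_into UNIV \<sigma> k)"
          by (rule dig_enc[OF w1(1) k])
        moreover have "dig n p k (enc n p (\<lambda>k. ?w (inv_into UNIV \<sigma> (p + k)))) =
            ?w (inv_into UNIV \<sigma> (p + k))"
          by (rule dig_enc[OF w1(2) k])
        ultimately show "outer (u k) (u (p + k)) $$
            (dig n p k (enc n p (\<lambda>k. ?w (inv_into UNIV \<sigma> k))),
             dig n p k (enc n p (\<lambda>k. ?w (inv_into UNIV \<sigma> (p + k))))) =
          outer (u k) (u (p + k)) $$ (?w (inv_into UNIV \<sigma> k), ?w (inv_into UNIV \<sigma> (p + k)))"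
          by simp
      qed
      also have "\<dots> = (\<Prod>k = 1..p. u k $ ?w (inv_into UNIV \<sigma> k) * u (p + k) $ ?w (inv_into UNIV \<sigma> (p + k)))"
      proof (rule prod.cong[OF refl])
        fix k assume k: "k \<in> {1..p}"
        then have "dim_vec (u k) = n" "dim_vec (u (p + k)) = n" using u by auto
        then show "outer (u k) (u (p + k)) $$ (?w (inv_into UNIV \<sigma> k), ?w (inv_into UNIV \<sigma> (p + k))) =
          u k $ ?w (inv_into UNIV \<sigma> k) * u (p + k) $ ?w (inv_into UNIV \<sigma> (p + k))"
          using w1[OF k] by (simp add: outer_def)
      qed
      also have "\<dots> = (\<Prod>m = 1..2 * p. u m $ ?w (inv_into UNIV \<sigma> m))"
        by (rule prod_split2[symmetric])
      also have "\<dots> = (\<Prod>m = 1..2 * p. u (\<sigma> m) $ ?w m)"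
        by (subst prod.permute[OF \<sigma>]) (simp add: o_def permutes_inverses(2)[OF \<sigma>])
      also have "\<dots> = (\<Prod>k = 1..p. u (\<sigma> k) $ ?w k * u (\<sigma> (p + k)) $ ?w (p + k))"
        by (rule prod_split2)
      also have "\<dots> = (\<Prod>k = 1..p. outer (u (\<sigma> k)) (u (\<sigma> (p + k))) $$ (dig n p k i, dig n p k j))"
      proof (rule prod.cong[OF refl])
        fix k assume k: "k \<in> {1..p}"
        then have "dim_vec (u (\<sigma> k)) = n" "dim_vec (u (\<sigma> (p + k))) = n"
          using u permutes_double[OF \<sigma> k] by auto
        then show "u (\<sigma> k) $ ?w k * u (\<sigma> (p + k)) $ ?w (p + k) =
          outer (u (\<sigma> k)) (u (\<sigma> (p + k))) $$ (dig n p k i, dig n p k j)"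
          using k dig_less[OF ij(1) k] dig_less[OF ij(2) k] by (auto simp: outer_def multi_index_def)
      qed
      also have "\<dots> = kron_prod p (\<lambda>k. outer (u (\<sigma> k)) (u (\<sigma> (p + k)))) $$ (i, j)"
        by (rule kron_prod_index[OF c' ij, symmetric])
      finally show "realign_entries n p \<sigma> (kron_prod p (\<lambda>k. outer (u k) (u (p + k)))) $$ (i, j) =
        kron_prod p (\<lambda>k. outer (u (\<sigma> k)) (u (\<sigma> (p + k)))) $$ (i, j)" .
    qed (use C' in \<open>auto simp: realign_entries_def\<close>)
  qed
  moreover have "kron_prod p (\<lambda>k. outer (u k) (u (p + k))) \<in> carrier_mat (n ^ p) (n ^ p)"
    if "\<forall>k \<in> {1..2 * p}. u k \<in> carrier_vec n" for u
    using that by (intro kron_prod_carrier outer_carrier) auto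
  moreover have "realign_entries n p \<sigma> (X + Y) = realign_entries n p \<sigma> X + realign_entries n p \<sigma> Y"
    if "X \<in> carrier_mat (n ^ p) (n ^ p)" "Y \<in> carrier_mat (n ^ p) (n ^ p)" for X Y
    using that lt by (intro eq_matI) (auto simp: realign_entries_def)
  moreover have "realign_entries n p \<sigma> (c \<cdot>\<^sub>m X) = c \<cdot>\<^sub>m realign_entries n p \<sigma> X"
    if "X \<in> carrier_mat (n ^ p) (n ^ p)" for c X
    using that lt by (intro eq_matI) (auto simp: realign_entries_def)
  moreover have "realign_entries n p \<sigma> X \<in> carrier_mat (n ^ p) (n ^ p)" for X
    by (simp add: realign_entries_def)
  ultimately show ?thesis by (simp add: is_realignment_def)
qed

lemma is_realignment_unique:
  assumes \<sigma>: "\<sigma> permutes {1..2 * p}"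
    and R: "is_realignment n p \<sigma> R" and S: "is_realignment n p \<sigma> S"
    and X: "X \<in> carrier_mat (n ^ p) (n ^ p)"
  shows "R X = S X"
proof -
  let ?C = "carrier_mat (n ^ p) (n ^ p) :: complex Matrix.mat set"
  define u where "u a b = (\<lambda>m. unit_vec n (multi_index n p a b m) :: complex Matrix.vec)" for a b
  define E where "E a b = kron_prod p (\<lambda>k. outer (u a b k) (u a b (p + k)))" for a b
  have EC: "E a b \<in> ?C" for a b
    unfolding E_def u_def by (intro kron_prod_carrier outer_carrier) auto
  have RE: "R (E a b) = S (E a b)" for a b
  proof -
    have "\<forall>k \<in> {1..2 * p}. u a b k \<in> carrier_vec n" by (simp add: u_def)
    then show ?thesis using R S unfolding is_realignment_def E_def by presburger
  qed
  have Eij: "E a b $$ (i, j) = (if i = a \<and> j = b then 1 else 0)"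
    if l: "a < n ^ p" "b < n ^ p" "i < n ^ p" "j < n ^ p" for a b i j
  proof -
    have "E a b $$ (i, j) = (\<Prod>k = 1..p. outer (u a b k) (u a b (p + k)) $$ (dig n p k i, dig n p k j))"
      unfolding E_def u_def by (rule kron_prod_index[OF _ l(3,4)]) (auto intro!: outer_carrier)
    also have "\<dots> = (\<Prod>k = 1..p. if dig n p k i = dig n p k a \<and> dig n p k j = dig n p k b then 1 else 0)"
      by (rule prod.cong)
        (use l in \<open>auto simp: outer_def u_def multi_index_def dig_less unit_vec_def\<close>)
    also have "\<dots> = (if i = a \<and> j = b then 1 else 0)"
    proof (cases "i = a \<and> j = b")
      case False
      then obtain k where "k \<in> {1..p}" "\<not> (dig n p k i = dig n p k a \<and> dig n p k j = dig n p k b)"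
        using dig_inj[OF l(3) l(1)] dig_inj[OF l(4) l(2)] by blast
      then have "(\<Prod>k = 1..p. if dig n p k i = dig n p k a \<and> dig n p k j = dig n p k b
          then 1 else 0 :: complex) = 0"
        by (intro prod_zero) auto
      then show ?thesis using False by simp
    qed simp
    finally show ?thesis .
  qed
  have main: "R X = S X" if "finite F" "X \<in> ?C" 
    "\<And>i j. i < n ^ p \<Longrightarrow> j < n ^ p \<Longrightarrow> (i, j) \<notin> F \<Longrightarrow> X $$ (i, j) = 0"
    "F \<subseteq> {..<n ^ p} \<times> {..<n ^ p}" for F X
    using that
  proof (induction F arbitrary: X rule: finite_induct)
    case empty
    have "X = 0 \<cdot>\<^sub>m X" using empty by (intro eq_matI) auto
    moreover have "R (0 \<cdot>\<^sub>m X) = 0 \<cdot>\<^sub>m R X" "S (0 \<cdot>\<^sub>m X) = 0 \<cdot>\<^sub>m S X" "R X \<in> ?C" "S X \<in> ?C"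
      using R S empty by (auto simp: is_realignment_def Pi_iff)
    moreover have "0 \<cdot>\<^sub>m R X = 0 \<cdot>\<^sub>m S X" using calculation(4,5) by (intro eq_matI) auto
    ultimately show ?case by metis
  next
    case (insert ab F)
    obtain a b where ab: "ab = (a, b)" by (cases ab)
    have l: "a < n ^ p" "b < n ^ p" using insert.prems ab by auto
    define Y where "Y = Matrix.mat (n ^ p) (n ^ p) (\<lambda>ij. if ij = ab then 0 else X $$ ij)"
    have Y: "Y \<in> ?C" by (simp add: Y_def)
    have XY: "X = Y + X $$ ab \<cdot>\<^sub>m E a b"
      using insert.prems(1) EC[of a b] l by (intro eq_matI) (auto simp: Y_def Eij ab)
    have "R Y = S Y"
      by (rule insert.IH[OF Y]) (use insert.prems in \<open>auto simp: Y_def\<close>)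
    moreover have "R (Y + X $$ ab \<cdot>\<^sub>m E a b) = R Y + X $$ ab \<cdot>\<^sub>m R (E a b)"
      "S (Y + X $$ ab \<cdot>\<^sub>m E a b) = S Y + X $$ ab \<cdot>\<^sub>m S (E a b)"
      using R S Y EC[of a b] by (auto simp: is_realignment_def)
    ultimately show ?case using RE XY by metis
  qed
  show ?thesis
    by (rule main[of "{..<n ^ p} \<times> {..<n ^ p}", OF _ X]) auto
qed

lemma realign_exists_unique:
  assumes \<sigma>: "\<sigma> permutes {1..2 * p}"
  shows "\<exists>!R. R \<in> extensional (carrier_mat (n ^ p) (n ^ p)) \<and> is_realignment n p \<sigma> R"
proof (rule ex_ex1I)
  show "\<exists>R. R \<in> extensional (carrier_mat (n ^ p) (n ^ p)) \<and> is_realignment n p \<sigma> R"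
    using is_realignment_entries[OF \<sigma>] restrict_extensional by blast
  show "R = S"
    if "R \<in> extensional (carrier_mat (n ^ p) (n ^ p)) \<and> is_realignment n p \<sigma> R"
      "S \<in> extensional (carrier_mat (n ^ p) (n ^ p)) \<and> is_realignment n p \<sigma> S" for R S
    using that is_realignment_unique[OF \<sigma>, of n R S] by (metis extensionalityI)
qed

lemma realign_is_realignment:
  assumes "\<sigma> permutes {1..2 * p}"
  shows "is_realignment n p \<sigma> (realign n p \<sigma>)"
  using theI'[OF realign_exists_unique[OF assms, of n]] by (simp add: realign_def)

section \<open>Normalization and invariance of the Haar measure\<close>

lemma space_circle_haar [simp]: "space circle_haar = UNIV"
  and sets_circle_haar [simp, measurable_cong]: "sets circle_haar = sets borel"
  by (simp_all add: circle_haar_def)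

lemma measurable_cis [measurable]: "cis \<in> borel_measurable borel"
  by (intro borel_measurable_continuous_onI continuous_intros)

lemma prob_space_circle_haar: "prob_space circle_haar"
  unfolding circle_haar_def
proof (rule prob_space.prob_space_distr)
  show "prob_space (uniform_measure lborel {0..<2 * pi})"
    by (rule prob_space_uniform_measure) auto
qed simp

lemma prob_space_torus_haar: "prob_space (torus_haar n)"
  unfolding torus_haar_def by (rule prob_space_PiM) (rule prob_space_circle_haar)

lemma emeasure_circle_haar:
  assumes "B \<in> sets borel"
  shows "emeasure circle_haar B = emeasure lborel ({0..<2 * pi} \<inter> cis -` B) / ennreal (2 * pi)"
proof -
  have "cis -` B \<in> sets borel"
    using measurable_sets[OF measurable_cis assms] by simp
  then show ?thesis
    using assms unfolding circle_haar_def
    by (subst emeasure_distr) auto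
qed

lemma emeasure_lborel_shift:
  assumes "X \<in> sets borel"
  shows "emeasure lborel ((\<lambda>t. c + t) -` X) = emeasure lborel (X :: real set)"
proof -
  have "emeasure lborel X = emeasure (distr lborel borel ((+) c)) X"
    by (simp add: lborel_distr_plus)
  also have "\<dots> = emeasure lborel ((\<lambda>t. c + t) -` X)"
    using assms by (subst emeasure_distr) auto
  finally show ?thesis ..
qed

lemma circle_haar_invariant:
  assumes "cmod w = 1"
  shows "distr circle_haar circle_haar ((*) w) = circle_haar"
proof (rule measure_eqI)
  fix A assume "A \<in> sets (distr circle_haar circle_haar ((*) w))"
  then have A: "A \<in> sets borel" by simp
  obtain a where a: "0 \<le> a" "a < 2 * pi" "w = cis a"
    using complex_unimodular_polar[of w] assms by (metis cis.ctr)
  define S where "S = cis -` A"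
  have S [measurable]: "S \<in> sets borel"
    using measurable_sets[OF measurable_cis A] by (simp add: S_def)
  have "cis (t + (a - 2 * pi)) = cis (t + a)" for t
  proof -
    have "cis (t + (a - 2 * pi)) = cis (t + a) / cis (2 * pi)"
      unfolding cis_divide by (simp add: add_diff_eq)
    then show ?thesis by simp
  qed
  then have periodic: "a - 2 * pi + t \<in> S \<longleftrightarrow> a + t \<in> S" for t
    by (simp add: S_def add.commute)
  have shift: "(\<lambda>t. c + t) -` X \<in> sets borel" if "X \<in> sets borel" for c and X :: "real set"
    using measurable_sets[of "\<lambda>t. c + t" borel borel X] that by simp
  have wA: "(*) w -` A \<in> sets borel"
    using measurable_sets[of "(*) w" borel borel A] A by simp
  have "{0..<2 * pi} \<inter> cis -` ((*) w -` A) = {0..<2 * pi} \<inter> (\<lambda>t. a + t) -` S"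
    by (auto simp: S_def a cis_mult)
  also have "\<dots> = (\<lambda>t. a + t) -` ({a..<2 * pi} \<inter> S) \<union> (\<lambda>t. a - 2 * pi + t) -` ({0..<a} \<inter> S)"
    using a by (auto simp: periodic)
  finally have "emeasure lborel ({0..<2 * pi} \<inter> cis -` ((*) w -` A)) =
      emeasure lborel ((\<lambda>t. a + t) -` ({a..<2 * pi} \<inter> S)) +
      emeasure lborel ((\<lambda>t. a - 2 * pi + t) -` ({0..<a} \<inter> S))"
    by (simp only:) (rule plus_emeasure[symmetric]; use shift in auto)
  also have "\<dots> = emeasure lborel ({a..<2 * pi} \<inter> S) + emeasure lborel ({0..<a} \<inter> S)"
    by (subst (1 2) emeasure_lborel_shift) auto
  also have "\<dots> = emeasure lborel (({a..<2 * pi} \<inter> S) \<union> ({0..<a} \<inter> S))"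
    by (rule plus_emeasure) auto
  also have "({a..<2 * pi} \<inter> S) \<union> ({0..<a} \<inter> S) = {0..<2 * pi} \<inter> S"
    using a by auto
  finally have "emeasure circle_haar ((*) w -` A) = emeasure circle_haar A"
    using A wA by (simp add: emeasure_circle_haar S_def)
  then show "emeasure (distr circle_haar circle_haar ((*) w)) A = emeasure circle_haar A"
    using A by (subst emeasure_distr) auto
qed simp

lemma torus_haar_invariant:
  assumes w: "\<forall>k<n. cmod (w k) = 1"
  shows "distr (torus_haar n) (torus_haar n) (\<lambda>z. \<lambda>k\<in>{..<n}. w k * z k) = torus_haar n"
proof -
  interpret P: product_prob_space "\<lambda>_ :: nat. circle_haar"
    by (rule product_prob_spaceI) (rule prob_space_circle_haar)
  have meas: "(\<lambda>z. \<lambda>k\<in>{..<n}. w k * z k) \<in> measurable (torus_haar n) (torus_haar n)"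
    unfolding torus_haar_def by measurable
  show ?thesis
    unfolding torus_haar_def
  proof (rule P.PiM_eqI)
    fix A :: "nat \<Rightarrow> complex set" assume A: "\<And>k. k \<in> {..<n} \<Longrightarrow> A k \<in> sets circle_haar"
    have wA: "(*) (w k) -` A k \<in> sets borel" if "k < n" for k
      using measurable_sets[of "(*) (w k)" borel borel "A k"] A that by simp
    have "emeasure (distr (PiM {..<n} (\<lambda>_. circle_haar)) (PiM {..<n} (\<lambda>_. circle_haar))
        (\<lambda>z. \<lambda>k\<in>{..<n}. w k * z k)) (PiE {..<n} A) =
      emeasure (PiM {..<n} (\<lambda>_. circle_haar)) (PiE {..<n} (\<lambda>k. (*) (w k) -` A k))"
      using meas A unfolding torus_haar_def
      by (subst emeasure_distr)
        (auto intro!: sets_PiM_I_finite arg_cong[of _ _ "emeasure _"] simp: space_PiM PiE_iff)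
    also have "\<dots> = (\<Prod>k<n. emeasure circle_haar ((*) (w k) -` A k))"
      using wA by (subst P.emeasure_PiM) auto
    also have "\<dots> = (\<Prod>k<n. emeasure circle_haar (A k))"
    proof (rule prod.cong[OF refl])
      fix k assume k: "k \<in> {..<n}"
      have "emeasure (distr circle_haar circle_haar ((*) (w k))) (A k) =
          emeasure circle_haar ((*) (w k) -` A k)"
        using A[OF k] by (subst emeasure_distr) auto
      then show "emeasure circle_haar ((*) (w k) -` A k) = emeasure circle_haar (A k)"
        using circle_haar_invariant[of "w k"] w k by simp
    qed
    finally show "emeasure (distr (PiM {..<n} (\<lambda>_. circle_haar)) (PiM {..<n} (\<lambda>_. circle_haar))
        (\<lambda>z. \<lambda>k\<in>{..<n}. w k * z k)) (PiE {..<n} A) = (\<Prod>k<n. emeasure circle_haar (A k))" .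
  qed auto
qed

end

theory Submission
  imports Defs
begin

text \<open>
  The realigned product \<open>R\<^sub>\<sigma>(v\<^sub>1 v\<^sub>1\<^sup>* \<otimes> \<dots> \<otimes> v\<^sub>p v\<^sub>p\<^sup>*)\<close> has rank at most one: it is
  \<open>a b\<^sup>T\<close>, where \<open>a\<close> and \<open>b\<close> are Kronecker products which share out the \<open>2p\<close> vectors
  \<open>v\<^sub>1, \<dots>, v\<^sub>p\<close> and their conjugates. Whatever the permutation, its trace norm
  \<open>\<parallel>a\<parallel> \<parallel>b\<parallel>\<close> is the product of all \<open>2p\<close> norms, which is the right-hand side of the inequality.

  The twirl averages the products \<open>U v\<^sub>1 (U v\<^sub>1)\<^sup>* \<otimes> \<dots> \<otimes> U v\<^sub>p (U v\<^sub>p)\<^sup>*\<close> over the diagonal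
  unitaries \<open>U\<close>. Realignment is linear, hence commutes with this average
  (\<open>realign_twirl_index\<close>), and \<open>U\<close> preserves norms. So the matrix in question is an average of
  rank one matrices of one and the same trace norm, and convexity of the trace norm finishes the
  proof.

  Convexity enters through duality. If the \<open>q\<^sub>a\<close> are orthonormal eigenvectors of \<open>A\<^sup>* A\<close> for
  all its nonzero eigenvalues \<open>\<lambda>\<^sub>a\<close>, counted with multiplicity, then the vectors \<open>w\<^sub>a = A q\<^sub>a / \<surd>\<lambda>\<^sub>a\<close> are orthonormal as well, and the
  trace norm of \<open>A\<close> equals \<open>\<Sum>\<^sub>a \<langle>w\<^sub>a, A q\<^sub>a\<rangle>\<close> (\<open>trace_norm_attained\<close>). For fixed \<open>w\<close> and
  \<open>q\<close> this expression is linear in \<open>A\<close>, so it may be computed under the integral, and on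
  a rank one matrix \<open>a b\<^sup>T\<close> the inequalities of Bessel and Cauchy-Schwarz bound it by
  \<open>\<parallel>a\<parallel> \<parallel>b\<parallel>\<close> (\<open>rank_one_bound\<close>). What remains is the finite-dimensional spectral
  theorem (\<open>hermitian_spectral\<close>) and the uniqueness of positive semidefinite square roots
  (\<open>psd_sqrt_unique\<close>), on which the definition of the trace norm rests.
\<close>

section \<open>Orthonormal families\<close>

text \<open>Vectors are coordinate functions, of which only the first \<open>n\<close> values count: a family of
  them can then be extended and rescaled without reference to carrier sets.\<close>

definition orthonormal :: "nat \<Rightarrow> nat \<Rightarrow> (nat \<Rightarrow> nat \<Rightarrow> complex) \<Rightarrow> bool" where
  "orthonormal n k q \<longleftrightarrow> (\<forall>a<k. \<forall>b<k. (\<Sum>i<n. q a i * cnj (q b i)) = (if a = b then 1 else 0))"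

lemma of_real_sum_cmod_square: "complex_of_real (\<Sum>i\<in>I. (cmod (x i))\<^sup>2) = (\<Sum>i\<in>I. x i * cnj (x i))"
  by (simp only: of_real_sum complex_norm_square)

lemma bessel:
  assumes q: "orthonormal n k q"
  shows "(\<Sum>a<k. (cmod (\<Sum>i<n. x i * cnj (q a i)))\<^sup>2) \<le> (\<Sum>i<n. (cmod (x i))\<^sup>2)"
proof -
  define c where "c a = (\<Sum>i<n. x i * cnj (q a i))" for a
  define r where "r i = x i - (\<Sum>a<k. c a * q a i)" for i
  \<comment> \<open>\<open>r\<close> is what remains of \<open>x\<close> after projecting onto the span; the claim amounts to \<open>\<parallel>r\<parallel>\<^sup>2 \<ge> 0\<close>.\<close>
  have rq: "(\<Sum>i<n. r i * cnj (q b i)) = 0" if "b < k" for b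
  proof -
    have "(\<Sum>i<n. r i * cnj (q b i)) = c b - (\<Sum>i<n. \<Sum>a<k. c a * (q a i * cnj (q b i)))"
      by (simp add: r_def c_def algebra_simps sum_subtractf sum_distrib_right sum_distrib_left)
    also have "(\<Sum>i<n. \<Sum>a<k. c a * (q a i * cnj (q b i))) = (\<Sum>a<k. c a * (\<Sum>i<n. q a i * cnj (q b i)))"
      unfolding sum_distrib_left by (rule sum.swap)
    also have "\<dots> = (\<Sum>a<k. c a * (if a = b then 1 else 0))"
      using q that by (intro sum.cong) (auto simp: orthonormal_def)
    finally show ?thesis using that by (simp add: if_distrib cong: if_cong)
  qed
  have cr: "r i * cnj (r i) = r i * cnj (x i) - (\<Sum>a<k. cnj (c a) * (r i * cnj (q a i)))" for i
  proof -
    have "cnj (r i) = cnj (x i) - (\<Sum>a<k. cnj (c a) * cnj (q a i))" by (simp add: r_def)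
    then show ?thesis by (simp add: right_diff_distrib sum_distrib_left mult_ac)
  qed
  have "complex_of_real (\<Sum>i<n. (cmod (r i))\<^sup>2) = (\<Sum>i<n. r i * cnj (r i))"
    by (rule of_real_sum_cmod_square)
  also have "\<dots> = (\<Sum>i<n. r i * cnj (x i)) - (\<Sum>i<n. \<Sum>a<k. cnj (c a) * (r i * cnj (q a i)))"
    by (simp only: cr sum_subtractf)
  also have "(\<Sum>i<n. \<Sum>a<k. cnj (c a) * (r i * cnj (q a i))) = (\<Sum>a<k. cnj (c a) * (\<Sum>i<n. r i * cnj (q a i)))"
    unfolding sum_distrib_left by (rule sum.swap)
  also have "\<dots> = 0" using rq by simp
  also have "(\<Sum>i<n. r i * cnj (x i)) = (\<Sum>i<n. x i * cnj (x i)) - (\<Sum>i<n. \<Sum>a<k. c a * cnj (x i * cnj (q a i)))"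
    by (simp add: r_def algebra_simps sum_subtractf sum_distrib_left sum_distrib_right)
  also have "(\<Sum>i<n. \<Sum>a<k. c a * cnj (x i * cnj (q a i))) = (\<Sum>a<k. c a * cnj (c a))"
  proof -
    have "(\<Sum>a<k. c a * cnj (c a)) = (\<Sum>a<k. c a * (\<Sum>i<n. cnj (x i * cnj (q a i))))"
      by (intro sum.cong refl) (simp add: c_def)
    then show ?thesis by (simp only: sum_distrib_left) (rule sum.swap)
  qed
  finally have "complex_of_real (\<Sum>i<n. (cmod (r i))\<^sup>2) =
      complex_of_real ((\<Sum>i<n. (cmod (x i))\<^sup>2) - (\<Sum>a<k. (cmod (c a))\<^sup>2))"
    by (simp only: of_real_sum_cmod_square of_real_diff diff_zero)
  then have "(\<Sum>i<n. (cmod (r i))\<^sup>2) = (\<Sum>i<n. (cmod (x i))\<^sup>2) - (\<Sum>a<k. (cmod (c a))\<^sup>2)"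
    using of_real_eq_iff by blast
  moreover have "0 \<le> (\<Sum>i<n. (cmod (r i))\<^sup>2)" by (simp add: sum_nonneg)
  ultimately show ?thesis by (simp add: c_def)
qed

lemma orthonormal_norm:
  assumes "orthonormal n k q" "a < k"
  shows "(\<Sum>i<n. (cmod (q a i))\<^sup>2) = 1"
proof -
  have "complex_of_real (\<Sum>i<n. (cmod (q a i))\<^sup>2) = (\<Sum>i<n. q a i * cnj (q a i))"
    by (rule of_real_sum_cmod_square)
  also have "\<dots> = 1" using assms by (simp add: orthonormal_def)
  finally show ?thesis using of_real_eq_1_iff by blast
qed

text \<open>Bessel's inequality for the standard basis vectors says that the squared entries at any fixed
  coordinate add up to at most one over the family; the sum over all coordinates counts the
  family. This bound lets the deflation in \<open>hermitian_spectral\<close> stop.\<close>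

lemma orthonormal_size:
  assumes q: "orthonormal n k q"
  shows "k \<le> n"
proof -
  have *: "(\<Sum>a<k. (cmod (q a i))\<^sup>2) \<le> 1" if "i < n" for i
  proof -
    have "(\<Sum>j<n. (if j = i then 1 else 0) * cnj (q a j)) = cnj (q a i)" for a
      using that by (simp add: if_distrib[of "\<lambda>x. x * _"] cong: if_cong)
    moreover have "(\<Sum>j<n. (cmod (if j = i then 1 else 0))\<^sup>2) = 1"
      using that by (simp add: if_distrib[of cmod] if_distrib[of "\<lambda>x. x ^ 2"] cong: if_cong)
    ultimately show ?thesis
      using bessel[OF q, of "\<lambda>j. if j = i then 1 else 0"] by simp
  qed
  have "real k = (\<Sum>a<k. \<Sum>i<n. (cmod (q a i))\<^sup>2)"
    using orthonormal_norm[OF q] by simp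
  also have "\<dots> = (\<Sum>i<n. \<Sum>a<k. (cmod (q a i))\<^sup>2)" by (rule sum.swap)
  also have "\<dots> \<le> (\<Sum>i<n. 1)" by (rule sum_mono) (use * in auto)
  finally show ?thesis by simp
qed

section \<open>The spectral theorem\<close>

definition hermitian :: "nat \<Rightarrow> (nat \<Rightarrow> nat \<Rightarrow> complex) \<Rightarrow> bool" where
  "hermitian n h \<longleftrightarrow> (\<forall>i<n. \<forall>j<n. h j i = cnj (h i j))"

lemma mat_trace_mult_commute:
  assumes A: "A \<in> carrier_mat n m" and B: "B \<in> carrier_mat m n"
  shows "mat_trace (A * B) = mat_trace (B * A)"
proof -
  have "mat_trace (A * B) = (\<Sum>i<n. \<Sum>j<m. A $$ (i, j) * B $$ (j, i))"
    using A B by (simp add: mat_trace_def scalar_prod_def lessThan_atLeast0)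
  also have "\<dots> = (\<Sum>j<m. \<Sum>i<n. B $$ (j, i) * A $$ (i, j))"
    by (subst sum.swap) (simp add: mult.commute)
  also have "\<dots> = mat_trace (B * A)"
    using A B by (simp add: mat_trace_def scalar_prod_def lessThan_atLeast0)
  finally show ?thesis .
qed

text \<open>For Hermitian \<open>A\<close>, the trace of \<open>A\<^sup>2\<close> is the sum of the squared absolute values of all
  entries, so it is positive unless \<open>A = 0\<close>. By Schur triangularization it is also the sum of the
  squares of the eigenvalues. Hence they cannot all vanish.\<close>

lemma hermitian_nonzero_eigenvector:
  assumes h: "hermitian n h" and nz: "i0 < n" "j0 < n" "h i0 j0 \<noteq> 0"
  shows "\<exists>(e :: real) x. e \<noteq> 0 \<and> (\<Sum>i<n. x i * cnj (x i)) = 1 \<and>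
    (\<forall>i<n. (\<Sum>j<n. h i j * x j) = of_real e * x i)"
proof -
  have herm: "h j i = cnj (h i j)" if "i < n" "j < n" for i j
    using h that unfolding hermitian_def by blast
  define A where "A = Matrix.mat n n (\<lambda>(i, j). h i j)"
  have A: "A \<in> carrier_mat n n" by (simp add: A_def)
  obtain es where es: "char_poly A = (\<Prod>a\<leftarrow>es. [:- a, 1:])"
    using char_poly_factorized[OF A] by auto
  obtain B where B: "B \<in> carrier_mat n n" "upper_triangular B" and "similar_mat A B"
    using schur_decomposition_exists[OF A es] by auto
  then obtain P Q where "similar_mat_wit A B P Q" by (auto simp: similar_mat_def)
  note PQ = similar_mat_witD2[OF A this]
  have P: "P \<in> carrier_mat n n" and Q: "Q \<in> carrier_mat n n" using PQ by auto
  have "A * A = P * (B * (Q * P) * B) * Q"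
    using P Q B(1) PQ(3) by (simp add: assoc_mult_mat[of _ n n _ n _ n])
  then have AA: "A * A = P * (B * B * Q)"
    using P Q B(1) PQ(2) by (simp add: assoc_mult_mat[of _ n n _ n _ n])
  then have "mat_trace (A * A) = mat_trace (B * B * Q * P)"
    using P Q B(1) by (simp add: mat_trace_mult_commute[of P n n])
  also have "B * B * Q * P = B * B"
    using P Q B(1) PQ(2) by (simp add: assoc_mult_mat[of _ n n _ n _ n])
  also have "mat_trace (B * B) = (\<Sum>i<n. \<Sum>j<n. B $$ (i, j) * B $$ (j, i))"
    using B by (simp add: mat_trace_def scalar_prod_def lessThan_atLeast0)
  also have "\<dots> = (\<Sum>i<n. \<Sum>j<n. if j = i then (B $$ (i, i))\<^sup>2 else 0)"
  proof (intro sum.cong refl)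
    fix i j assume "i \<in> {..<n}" "j \<in> {..<n}"
    then show "B $$ (i, j) * B $$ (j, i) = (if j = i then (B $$ (i, i))\<^sup>2 else 0)"
      using B upper_triangularD[OF B(2), of i j] upper_triangularD[OF B(2), of j i]
      by (cases i j rule: linorder_cases) (auto simp: power2_eq_square)
  qed
  also have "\<dots> = (\<Sum>i<n. (B $$ (i, i))\<^sup>2)" by simp
  finally have trB: "mat_trace (A * A) = (\<Sum>i<n. (B $$ (i, i))\<^sup>2)" .
  have "mat_trace (A * A) = (\<Sum>i<n. \<Sum>j<n. h i j * h j i)"
    by (simp add: mat_trace_def A_def scalar_prod_def lessThan_atLeast0)
  also have "\<dots> = complex_of_real (\<Sum>i<n. \<Sum>j<n. (cmod (h i j))\<^sup>2)"
  proof -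
    have "h i j * h j i = complex_of_real ((cmod (h i j))\<^sup>2)" if "i < n" "j < n" for i j
      by (simp only: herm[OF that] complex_norm_square)
    then show ?thesis by (simp del: of_real_power)
  qed
  moreover have "(\<Sum>i<n. \<Sum>j<n. (cmod (h i j))\<^sup>2) > 0"
  proof (rule sum_pos2[of _ i0])
    show "(\<Sum>j<n. (cmod (h i0 j))\<^sup>2) > 0"
      by (rule sum_pos2[of _ j0]) (use nz in auto)
  qed (use nz in \<open>auto intro: sum_nonneg\<close>)
  ultimately have "mat_trace (A * A) \<noteq> 0" by (simp del: of_real_sum)
  then have "\<exists>d\<in>{..<n}. (B $$ (d, d))\<^sup>2 \<noteq> 0"
    unfolding trB by (rule contrapos_np) (auto intro: sum.neutral)
  then obtain d where d: "d < n" "B $$ (d, d) \<noteq> 0" by auto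
  define e where "e = B $$ (d, d)"
  have "char_poly A = (\<Prod>a\<leftarrow>diag_mat B. [:- a, 1:])"
    using char_poly_similar[OF \<open>similar_mat A B\<close>] char_poly_upper_triangular[OF B] by simp
  moreover have "e \<in> set (diag_mat B)" using d B by (auto simp: diag_mat_def e_def)
  ultimately have "poly (char_poly A) e = 0" using linear_poly_root by metis
  then have "eigenvalue A e" using eigenvalue_root_char_poly[OF A] by simp
  then obtain y where y: "y \<in> carrier_vec n" "y \<noteq> 0\<^sub>v n" "A *\<^sub>v y = e \<cdot>\<^sub>v y"
    using A by (auto simp: eigenvalue_def eigenvector_def)
  have Ay: "(\<Sum>j<n. h i j * y $ j) = e * y $ i" if "i < n" for i
    using arg_cong[OF y(3), of "\<lambda>v. v $ i"] y(1) that
    by (simp add: A_def scalar_prod_def lessThan_atLeast0)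
  define s where "s = (\<Sum>i<n. (cmod (y $ i))\<^sup>2)"
  have s: "s > 0"
  proof -
    obtain i where "i < n" "y $ i \<noteq> 0" using y by (metis carrier_vecD eq_vecI index_zero_vec)
    then show ?thesis unfolding s_def by (intro sum_pos2[of _ i]) auto
  qed
  have cs: "complex_of_real s = (\<Sum>i<n. y $ i * cnj (y $ i))"
    unfolding s_def by (rule of_real_sum_cmod_square)
  \<comment> \<open>The Rayleigh quotient of \<open>y\<close> shows that \<open>e\<close> is real.\<close>
  have q: "e * of_real s = (\<Sum>i<n. \<Sum>j<n. h i j * y $ j * cnj (y $ i))"
    unfolding cs sum_distrib_left
    by (intro sum.cong refl) (simp add: Ay sum_distrib_right[symmetric])
  have "cnj (e * of_real s) = (\<Sum>i<n. \<Sum>j<n. h j i * y $ i * cnj (y $ j))"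
  proof -
    have *: "cnj (h i j * y $ j * cnj (y $ i)) = h j i * y $ i * cnj (y $ j)" if "i < n" "j < n" for i j
      by (simp add: herm[OF that] mult_ac)
    show ?thesis unfolding q cnj_sum by (intro sum.cong refl *) auto
  qed
  also have "\<dots> = e * of_real s" unfolding q by (rule sum.swap)
  finally have "cnj e = e" using s by simp
  then obtain e' where e': "e = of_real e'" by (metis Reals_cases Reals_cnj_iff)
  define x where "x i = y $ i / of_real (sqrt s)" for i
  show ?thesis
  proof (intro exI[of _ e'] exI[of _ x] conjI allI impI)
    show "e' \<noteq> 0" using d e' by (auto simp: e_def)
    have "(\<Sum>i<n. x i * cnj (x i)) = (\<Sum>i<n. y $ i * cnj (y $ i)) / (of_real (sqrt s) * of_real (sqrt s))"
      by (simp add: x_def sum_divide_distrib)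
    also have "of_real (sqrt s) * of_real (sqrt s) = complex_of_real s"
      using s by (simp flip: of_real_mult)
    finally show "(\<Sum>i<n. x i * cnj (x i)) = 1" using s by (simp add: cs[symmetric])
    show "(\<Sum>j<n. h i j * x j) = of_real e' * x i" if "i < n" for i
      using Ay[OF that] by (simp add: x_def e' sum_divide_distrib[symmetric])
  qed
qed

lemma hermitian_self_adjoint:
  assumes "hermitian n h"
  shows "(\<Sum>i<n. (\<Sum>j<n. h i j * y j) * cnj (z i)) = (\<Sum>j<n. y j * cnj (\<Sum>i<n. h j i * z i))"
proof -
  have "(\<Sum>i<n. (\<Sum>j<n. h i j * y j) * cnj (z i)) = (\<Sum>j<n. \<Sum>i<n. h i j * y j * cnj (z i))"
    by (subst sum.swap) (simp add: sum_distrib_right)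
  also have "\<dots> = (\<Sum>j<n. \<Sum>i<n. y j * cnj (h j i * z i))"
  proof (intro sum.cong refl)
    fix j i assume "j \<in> {..<n}" "i \<in> {..<n}"
    then have "h i j = cnj (h j i)" using assms unfolding hermitian_def by blast
    then show "h i j * y j * cnj (z i) = y j * cnj (h j i * z i)" by simp
  qed
  finally show ?thesis by (simp add: sum_distrib_left)
qed

text \<open>Take as many orthonormal eigenvectors with nonzero eigenvalues as possible and subtract their
  part from \<open>h\<close>. If the difference \<open>g\<close> were not zero, it would have an eigenvector with nonzero
  eigenvalue. Since \<open>g\<close> annihilates the given eigenvectors, the new one is orthogonal to them
  and thus an eigenvector of \<open>h\<close> too, against maximality. The
  family spans the range of \<open>h\<close>.\<close>

lemma hermitian_spectral:
  assumes h: "hermitian n h"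
  shows "\<exists>k lam q. orthonormal n k q \<and> (\<forall>a<k. lam a \<noteq> (0::real)) \<and>
    (\<forall>i<n. \<forall>j<n. h i j = (\<Sum>a<k. of_real (lam a) * q a i * cnj (q a j)))"
proof -
  have herm: "h j i = cnj (h i j)" if "i < n" "j < n" for i j
    using h that unfolding hermitian_def by blast
  define E where "E k \<longleftrightarrow> (\<exists>q lam. orthonormal n k q \<and>
    (\<forall>a<k. lam a \<noteq> (0::real) \<and> (\<forall>i<n. (\<Sum>j<n. h i j * q a j) = of_real (lam a) * q a i)))" for k
  have "E 0" by (simp add: E_def orthonormal_def)
  moreover have "\<forall>k. E k \<longrightarrow> k \<le> n" using orthonormal_size by (auto simp: E_def)
  ultimately obtain k where "E k" and kmax: "\<And>k'. E k' \<Longrightarrow> k' \<le> k"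
    using Nat.ex_has_greatest_nat[of E 0 n] by auto
  then obtain q lam where q: "orthonormal n k q" and eigen:
    "\<forall>a<k. lam a \<noteq> (0::real) \<and> (\<forall>i<n. (\<Sum>j<n. h i j * q a j) = of_real (lam a) * q a i)"
    unfolding E_def by blast
  then have lam: "\<And>a. a < k \<Longrightarrow> lam a \<noteq> 0"
    and ev: "\<And>a i. a < k \<Longrightarrow> i < n \<Longrightarrow> (\<Sum>j<n. h i j * q a j) = of_real (lam a) * q a i"
    by auto
  define g where "g i j = h i j - (\<Sum>a<k. of_real (lam a) * q a i * cnj (q a j))" for i j
  have gherm: "g j i = cnj (g i j)" if "i < n" "j < n" for i j
    by (simp add: g_def herm[OF that] mult_ac)
  then have gherm': "hermitian n g" unfolding hermitian_def by blast
  have gx: "(\<Sum>j<n. g i j * x j) =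
      (\<Sum>j<n. h i j * x j) - (\<Sum>a<k. of_real (lam a) * q a i * (\<Sum>j<n. x j * cnj (q a j)))" for x i
  proof -
    have "(\<Sum>j<n. g i j * x j) = (\<Sum>j<n. h i j * x j) -
        (\<Sum>j<n. \<Sum>a<k. of_real (lam a) * q a i * (x j * cnj (q a j)))"
      unfolding g_def left_diff_distrib sum_subtractf sum_distrib_right by (simp add: mult_ac)
    also have "(\<Sum>j<n. \<Sum>a<k. of_real (lam a) * q a i * (x j * cnj (q a j))) =
        (\<Sum>a<k. of_real (lam a) * q a i * (\<Sum>j<n. x j * cnj (q a j)))"
      unfolding sum_distrib_left by (rule sum.swap)
    finally show ?thesis .
  qed
  have gq: "(\<Sum>j<n. g i j * q b j) = 0" if "b < k" "i < n" for b i
  proof -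
    have "(\<Sum>a<k. of_real (lam a) * q a i * (\<Sum>j<n. q b j * cnj (q a j))) =
        (\<Sum>a<k. if a = b then of_real (lam b) * q b i else 0)"
      using q that(1) by (intro sum.cong) (auto simp: orthonormal_def)
    then show ?thesis using that by (simp add: gx ev)
  qed
  have "g i j = 0" if ij: "i < n" "j < n" for i j
  proof (rule ccontr)
    assume nz: "g i j \<noteq> 0"
    obtain e :: real and x where e: "e \<noteq> 0" and x: "(\<Sum>i<n. x i * cnj (x i)) = 1"
      and gev: "\<And>i. i < n \<Longrightarrow> (\<Sum>j<n. g i j * x j) = of_real e * x i"
      using hermitian_nonzero_eigenvector[OF gherm' ij nz] by blast
    have orth: "(\<Sum>i<n. x i * cnj (q a i)) = 0" if a: "a < k" for a
    proof -
      have "of_real e * (\<Sum>i<n. x i * cnj (q a i)) = (\<Sum>i<n. (\<Sum>j<n. g i j * x j) * cnj (q a i))"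
        by (simp add: sum_distrib_left gev mult.assoc)
      also have "\<dots> = (\<Sum>j<n. x j * cnj (\<Sum>i<n. g j i * q a i))"
        by (rule hermitian_self_adjoint[OF gherm'])
      also have "\<dots> = 0" using a by (simp add: gq)
      finally show ?thesis using e by simp
    qed
    have orth': "(\<Sum>i<n. q a i * cnj (x i)) = 0" if "a < k" for a
    proof -
      have "(\<Sum>i<n. q a i * cnj (x i)) = cnj (\<Sum>i<n. x i * cnj (q a i))" by (simp add: mult.commute)
      then show ?thesis using orth[OF that] by simp
    qed
    have "orthonormal n (Suc k) (q(k := x))"
      using q x orth orth' by (auto simp: orthonormal_def less_Suc_eq)
    moreover have "\<forall>a<Suc k. (lam(k := e)) a \<noteq> 0 \<and>
        (\<forall>i<n. (\<Sum>j<n. h i j * (q(k := x)) a j) = of_real ((lam(k := e)) a) * (q(k := x)) a i)"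
      using lam e ev gev by (auto simp: less_Suc_eq gx orth)
    ultimately have "E (Suc k)" unfolding E_def by blast
    then show False using kmax by fastforce
  qed
  then have "h i j = (\<Sum>a<k. of_real (lam a) * q a i * cnj (q a j))" if "i < n" "j < n" for i j
    using that by (simp add: g_def)
  then show ?thesis using q lam by blast
qed

section \<open>Positive semidefinite square roots\<close>

lemma mat_adjoint_dim [simp]:
  "dim_row (mat_adjoint A) = dim_col A" "dim_col (mat_adjoint A) = dim_row A"
  by (simp_all add: mat_adjoint_def)

lemma mat_adjoint_index:
  "i < dim_col A \<Longrightarrow> j < dim_row A \<Longrightarrow> mat_adjoint A $$ (i, j) = cnj (A $$ (j, i))"
  for A :: "complex Matrix.mat"
  by (simp add: mat_adjoint_def mat_of_rows_index)

lemma hermitian_iff: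
  assumes "B \<in> carrier_mat n n"
  shows "mat_adjoint B = B \<longleftrightarrow> hermitian n (\<lambda>i j. B $$ (i, j))"
  unfolding hermitian_def
proof
  assume adj: "mat_adjoint B = B"
  show "\<forall>i<n. \<forall>j<n. B $$ (j, i) = cnj (B $$ (i, j))"
  proof (intro allI impI)
    fix i j assume "i < n" "j < n"
    then have "mat_adjoint B $$ (j, i) = cnj (B $$ (i, j))" using assms by (simp add: mat_adjoint_index)
    then show "B $$ (j, i) = cnj (B $$ (i, j))" by (simp only: adj)
  qed
next
  assume "\<forall>i<n. \<forall>j<n. B $$ (j, i) = cnj (B $$ (i, j))"
  then have "mat_adjoint B $$ (i, j) = B $$ (i, j)" if "i < n" "j < n" for i j
    using that assms by (metis carrier_matD mat_adjoint_index)
  then show "mat_adjoint B = B" using assms by (intro eq_matI) auto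
qed

lemma quadratic_form:
  assumes "B \<in> carrier_mat n n"
  shows "(B *\<^sub>v Matrix.vec n x) \<bullet>c Matrix.vec n x = (\<Sum>i<n. (\<Sum>j<n. B $$ (i, j) * x j) * cnj (x i))"
  using assms by (simp add: scalar_prod_def lessThan_atLeast0)

definition spectral_mat :: "nat \<Rightarrow> nat \<Rightarrow> (nat \<Rightarrow> real) \<Rightarrow> (nat \<Rightarrow> nat \<Rightarrow> complex) \<Rightarrow> complex Matrix.mat" where
  "spectral_mat n k lam q = Matrix.mat n n (\<lambda>(i, j). \<Sum>a<k. of_real (lam a) * q a i * cnj (q a j))"

lemma spectral_mat_mult:
  assumes q: "orthonormal n k q"
  shows "spectral_mat n k lam q * spectral_mat n k mu q = spectral_mat n k (\<lambda>a. lam a * mu a) q"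
proof (rule eq_matI)
  fix i j assume "i < dim_row (spectral_mat n k (\<lambda>a. lam a * mu a) q)"
    "j < dim_col (spectral_mat n k (\<lambda>a. lam a * mu a) q)"
  then have ij: "i < n" "j < n" by (simp_all add: spectral_mat_def)
  have "(spectral_mat n k lam q * spectral_mat n k mu q) $$ (i, j) =
      (\<Sum>l<n. (\<Sum>a<k. of_real (lam a) * q a i * cnj (q a l)) * (\<Sum>b<k. of_real (mu b) * q b l * cnj (q b j)))"
    using ij by (simp add: spectral_mat_def scalar_prod_def lessThan_atLeast0)
  also have "\<dots> = (\<Sum>l<n. \<Sum>a<k. \<Sum>b<k. of_real (lam a * mu b) * q a i * cnj (q b j) * (q b l * cnj (q a l)))"
    by (simp add: sum_product mult_ac)
  also have "\<dots> = (\<Sum>a<k. \<Sum>b<k. \<Sum>l<n. of_real (lam a * mu b) * q a i * cnj (q b j) * (q b l * cnj (q a l)))"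
    by (subst sum.swap) (intro sum.cong refl sum.swap)
  also have "\<dots> = (\<Sum>a<k. \<Sum>b<k. of_real (lam a * mu b) * q a i * cnj (q b j) * (if b = a then 1 else 0))"
    using q by (intro sum.cong refl) (auto simp: orthonormal_def sum_distrib_left[symmetric])
  also have "\<dots> = (\<Sum>a<k. of_real (lam a * mu a) * q a i * cnj (q a j))"
    by (simp add: if_distrib[of "\<lambda>x. _ * x"] cong: if_cong)
  finally show "(spectral_mat n k lam q * spectral_mat n k mu q) $$ (i, j) =
      spectral_mat n k (\<lambda>a. lam a * mu a) q $$ (i, j)"
    using ij by (simp add: spectral_mat_def)
qed (simp_all add: spectral_mat_def)

lemma spectral_mat_eigenvector:
  assumes q: "orthonormal n k q" and "b < k" "i < n"
  shows "(\<Sum>j<n. spectral_mat n k lam q $$ (i, j) * q b j) = of_real (lam b) * q b i"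
proof -
  have "(\<Sum>j<n. spectral_mat n k lam q $$ (i, j) * q b j) =
      (\<Sum>j<n. \<Sum>a<k. of_real (lam a) * q a i * (q b j * cnj (q a j)))"
    using assms by (simp add: spectral_mat_def sum_distrib_left sum_distrib_right mult_ac)
  also have "\<dots> = (\<Sum>a<k. of_real (lam a) * q a i * (\<Sum>j<n. q b j * cnj (q a j)))"
    unfolding sum_distrib_left by (rule sum.swap)
  also have "\<dots> = (\<Sum>a<k. of_real (lam a) * q a i * (if a = b then 1 else 0))"
    using q assms(2) by (intro sum.cong) (auto simp: orthonormal_def)
  finally show ?thesis using assms(2) by (simp add: if_distrib[of "\<lambda>x. _ * x"] cong: if_cong)
qed

lemma spectral_mat_trace:
  assumes q: "orthonormal n k q"
  shows "mat_trace (spectral_mat n k lam q) = of_real (\<Sum>a<k. lam a)"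
proof -
  have "mat_trace (spectral_mat n k lam q) = (\<Sum>a<k. \<Sum>i<n. of_real (lam a) * (q a i * cnj (q a i)))"
    by (subst sum.swap) (simp add: mat_trace_def spectral_mat_def mult_ac)
  also have "\<dots> = (\<Sum>a<k. of_real (lam a))"
    using q by (intro sum.cong refl) (auto simp: orthonormal_def sum_distrib_left[symmetric])
  finally show ?thesis by simp
qed

lemma spectral_mat_pos_semidef:
  assumes lam: "\<And>a. a < k \<Longrightarrow> lam a \<ge> 0"
  shows "pos_semidef n (spectral_mat n k lam q)"
proof -
  let ?S = "spectral_mat n k lam q"
  have S: "?S \<in> carrier_mat n n" by (simp add: spectral_mat_def)
  have "mat_adjoint ?S = ?S"
    unfolding hermitian_iff[OF S] hermitian_def by (auto simp: spectral_mat_def mult_ac)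
  moreover have "0 \<le> Re ((?S *\<^sub>v x) \<bullet>c x)" if x: "x \<in> carrier_vec n" for x
  proof -
    have "x = Matrix.vec n (($) x)" using x by auto
    then have "(?S *\<^sub>v x) \<bullet>c x = (\<Sum>i<n. (\<Sum>j<n. ?S $$ (i, j) * x $ j) * cnj (x $ i))"
      using quadratic_form[OF S, of "($) x"] by simp
    also have "\<dots> = (\<Sum>i<n. \<Sum>j<n. \<Sum>a<k. of_real (lam a) * ((x $ j * cnj (q a j)) * cnj (x $ i * cnj (q a i))))"
      by (simp add: spectral_mat_def sum_distrib_left sum_distrib_right mult_ac)
    also have "\<dots> = (\<Sum>i<n. \<Sum>a<k. \<Sum>j<n. of_real (lam a) * ((x $ j * cnj (q a j)) * cnj (x $ i * cnj (q a i))))"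
      by (intro sum.cong refl sum.swap)
    also have "\<dots> = (\<Sum>a<k. \<Sum>i<n. \<Sum>j<n. of_real (lam a) * ((x $ j * cnj (q a j)) * cnj (x $ i * cnj (q a i))))"
      by (rule sum.swap)
    also have "\<dots> = (\<Sum>a<k. of_real (lam a) *
        ((\<Sum>j<n. x $ j * cnj (q a j)) * cnj (\<Sum>i<n. x $ i * cnj (q a i))))"
      unfolding cnj_sum sum_product unfolding sum_distrib_left by (intro sum.cong refl sum.swap)
    also have "\<dots> = of_real (\<Sum>a<k. lam a * (cmod (\<Sum>j<n. x $ j * cnj (q a j)))\<^sup>2)"
      unfolding of_real_sum of_real_mult complex_norm_square ..
    finally have "Re ((?S *\<^sub>v x) \<bullet>c x) = (\<Sum>a<k. lam a * (cmod (\<Sum>j<n. x $ j * cnj (q a j)))\<^sup>2)"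
      by (simp only: Re_complex_of_real)
    also have "\<dots> \<ge> 0" using lam by (intro sum_nonneg mult_nonneg_nonneg) auto
    finally show ?thesis .
  qed
  ultimately show ?thesis using S by (simp add: pos_semidef_def)
qed

text \<open>If \<open>B \<noteq> C\<close>, then \<open>B - C\<close> has a unit eigenvector \<open>x\<close> with real eigenvalue \<open>e \<noteq> 0\<close>. From
  \<open>B (B - C) + (B - C) C = B\<^sup>2 - C\<^sup>2 = 0\<close> it follows that \<open>e (x\<^sup>* B x + x\<^sup>* C x) = 0\<close>. Both terms
  are nonnegative, so both vanish; but their difference is \<open>e\<close>.\<close>

lemma psd_sqrt_unique:
  assumes B: "pos_semidef n B" and C: "pos_semidef n C" and BC: "B * B = C * C"
  shows "B = C"
proof (rule ccontr)
  assume "B \<noteq> C"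
  have cB: "B \<in> carrier_mat n n" and cC: "C \<in> carrier_mat n n"
    using B C by (auto simp: pos_semidef_def)
  have hB: "hermitian n (\<lambda>i j. B $$ (i, j))" and hC: "hermitian n (\<lambda>i j. C $$ (i, j))"
    using B C hermitian_iff[OF cB] hermitian_iff[OF cC] unfolding pos_semidef_def by blast+
  define g where "g i j = B $$ (i, j) - C $$ (i, j)" for i j
  have gherm: "hermitian n g"
    unfolding hermitian_def
  proof (intro allI impI)
    fix i j assume "i < n" "j < n"
    then have "B $$ (j, i) = cnj (B $$ (i, j))" "C $$ (j, i) = cnj (C $$ (i, j))"
      using hB hC unfolding hermitian_def by blast+
    then show "g j i = cnj (g i j)" by (simp add: g_def)
  qed
  obtain i0 j0 where nz: "i0 < n" "j0 < n" "g i0 j0 \<noteq> 0"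
    using \<open>B \<noteq> C\<close> cB cC by (auto simp: mat_eq_iff g_def)
  obtain e :: real and x where e: "e \<noteq> 0" and x: "(\<Sum>i<n. x i * cnj (x i)) = 1"
    and gev: "\<And>i. i < n \<Longrightarrow> (\<Sum>j<n. g i j * x j) = of_real e * x i"
    using hermitian_nonzero_eigenvector[OF gherm nz] by blast
  \<comment> \<open>\<open>b = B x\<close> and \<open>c = C x\<close> have the same norm because \<open>B\<^sup>2 = C\<^sup>2\<close>.\<close>
  define b c where "b i = (\<Sum>j<n. B $$ (i, j) * x j)" and "c i = (\<Sum>j<n. C $$ (i, j) * x j)" for i
  have bc: "b i - c i = of_real e * x i" if "i < n" for i
  proof -
    have "b i - c i = (\<Sum>j<n. g i j * x j)"
      unfolding b_def c_def g_def left_diff_distrib sum_subtractf ..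
    then show ?thesis using gev[OF that] by simp
  qed
  have sq: "(\<Sum>i<n. (\<Sum>j<n. A $$ (i, j) * (\<Sum>l<n. A $$ (j, l) * x l)) * cnj (x i)) =
      (\<Sum>i<n. (\<Sum>j<n. (A * A) $$ (i, j) * x j) * cnj (x i))"
    if A: "A \<in> carrier_mat n n" for A
  proof (rule sum.cong[OF refl], rule arg_cong2[where f = "(*)", OF _ refl])
    fix i assume i: "i \<in> {..<n}"
    have "(\<Sum>j<n. A $$ (i, j) * (\<Sum>l<n. A $$ (j, l) * x l)) = (\<Sum>l<n. \<Sum>j<n. A $$ (i, j) * A $$ (j, l) * x l)"
      by (subst sum.swap) (simp add: sum_distrib_left mult.assoc)
    also have "\<dots> = (\<Sum>l<n. (A * A) $$ (i, l) * x l)"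
      using A i by (intro sum.cong refl)
        (simp add: scalar_prod_def lessThan_atLeast0 sum_distrib_right)
    finally show "(\<Sum>j<n. A $$ (i, j) * (\<Sum>l<n. A $$ (j, l) * x l)) = (\<Sum>j<n. (A * A) $$ (i, j) * x j)" .
  qed
  have "(\<Sum>i<n. b i * cnj (b i)) = (\<Sum>i<n. (\<Sum>j<n. B $$ (i, j) * b j) * cnj (x i))"
    unfolding hermitian_self_adjoint[OF hB] unfolding b_def[symmetric] ..
  also have "\<dots> = (\<Sum>i<n. (\<Sum>j<n. C $$ (i, j) * c j) * cnj (x i))"
    unfolding b_def c_def sq[OF cB] sq[OF cC] BC ..
  also have "\<dots> = (\<Sum>i<n. c i * cnj (c i))"
    unfolding hermitian_self_adjoint[OF hC] unfolding c_def[symmetric] ..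
  finally have norms: "(\<Sum>i<n. b i * cnj (b i)) = (\<Sum>i<n. c i * cnj (c i))" .
  define \<beta> \<gamma> where "\<beta> = (\<Sum>i<n. b i * cnj (x i))" and "\<gamma> = (\<Sum>i<n. c i * cnj (x i))"
  have "0 \<le> Re ((B *\<^sub>v Matrix.vec n x) \<bullet>c Matrix.vec n x)"
    "0 \<le> Re ((C *\<^sub>v Matrix.vec n x) \<bullet>c Matrix.vec n x)"
    using B C vec_carrier[of n x] unfolding pos_semidef_def by blast+
  then have pos: "Re \<beta> \<ge> 0" "Re \<gamma> \<ge> 0"
    unfolding quadratic_form[OF cB] quadratic_form[OF cC] \<beta>_def \<gamma>_def b_def c_def .
  have diff: "\<beta> - \<gamma> = of_real e"
  proof -
    have "\<beta> - \<gamma> = (\<Sum>i<n. (b i - c i) * cnj (x i))"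
      by (simp add: \<beta>_def \<gamma>_def left_diff_distrib sum_subtractf)
    also have "\<dots> = of_real e * (\<Sum>i<n. x i * cnj (x i))" by (simp add: bc sum_distrib_left mult.assoc)
    finally show ?thesis using x by simp
  qed
  have "of_real e * (cnj \<beta> + \<gamma>) = (\<Sum>i<n. of_real e * x i * cnj (b i) + c i * cnj (of_real e * x i))"
    by (simp add: \<beta>_def \<gamma>_def sum.distrib sum_distrib_left distrib_left mult_ac)
  also have "\<dots> = (\<Sum>i<n. (b i - c i) * cnj (b i) + c i * cnj (b i - c i))"
    by (intro sum.cong refl) (simp only: lessThan_iff bc)
  also have "\<dots> = (\<Sum>i<n. b i * cnj (b i)) - (\<Sum>i<n. c i * cnj (c i))"
    by (simp add: algebra_simps sum_subtractf sum.distrib)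
  finally have "cnj \<beta> + \<gamma> = 0" using e norms by simp
  then have "Re \<beta> + Re \<gamma> = 0" by (metis cnj.simps(1) plus_complex.simps(1) zero_complex.simps(1))
  then have "Re \<beta> - Re \<gamma> = 0" using pos by simp
  then show False using diff e by (metis Re_complex_of_real minus_complex.simps(1))
qed

lemma psd_sqrt_spectral_mat:
  assumes q: "orthonormal n k q" and lam: "\<And>a. a < k \<Longrightarrow> lam a \<ge> 0"
  shows "psd_sqrt (spectral_mat n k lam q) = spectral_mat n k (\<lambda>a. sqrt (lam a)) q"
proof -
  let ?R = "spectral_mat n k (\<lambda>a. sqrt (lam a)) q"
  have R: "pos_semidef n ?R" using lam by (intro spectral_mat_pos_semidef) simp
  have RR: "?R * ?R = spectral_mat n k lam q"
    unfolding spectral_mat_mult[OF q] using lam by (simp add: spectral_mat_def)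
  show ?thesis unfolding psd_sqrt_def
  proof (rule the_equality)
    show "pos_semidef (dim_row (spectral_mat n k lam q)) ?R \<and> ?R * ?R = spectral_mat n k lam q"
      using R RR by (simp add: spectral_mat_def)
    show "C = ?R" if "pos_semidef (dim_row (spectral_mat n k lam q)) C \<and> C * C = spectral_mat n k lam q" for C
    proof (rule psd_sqrt_unique)
      show "pos_semidef n C" using that by (simp add: spectral_mat_def)
      show "C * C = ?R * ?R" unfolding RR using that by blast
    qed (rule R)
  qed
qed

section \<open>Duality for the trace norm\<close>

text \<open>The \<open>q a\<close> are eigenvectors of \<open>A\<^sup>* A\<close> for its nonzero eigenvalues, which makes the normalized
  images \<open>w a\<close> of the \<open>q a\<close> under \<open>A\<close> orthonormal: both are families of singular
  vectors of \<open>A\<close>, for its nonzero singular values \<open>sqrt (lam a)\<close>.\<close>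

lemma trace_norm_attained:
  assumes A: "A \<in> carrier_mat n n"
  obtains k w q where "orthonormal n k w" "orthonormal n k q"
    "of_real (trace_norm A) = (\<Sum>a<k. \<Sum>i<n. \<Sum>j<n. A $$ (i, j) * q a j * cnj (w a i))"
proof -
  define h where "h i j = (mat_adjoint A * A) $$ (i, j)" for i j
  have h: "h i j = (\<Sum>l<n. A $$ (l, j) * cnj (A $$ (l, i)))" if "i < n" "j < n" for i j
    using A that by (simp add: h_def scalar_prod_def lessThan_atLeast0 mat_adjoint_index mult.commute)
  have "hermitian n h"
    unfolding hermitian_def by (auto simp: h mult.commute)
  from hermitian_spectral[OF this] obtain k lam q where q: "orthonormal n k q" and lam: "\<And>a. a < k \<Longrightarrow> lam a \<noteq> (0::real)"
    and hs: "\<And>i j. i < n \<Longrightarrow> j < n \<Longrightarrow> h i j = (\<Sum>a<k. of_real (lam a) * q a i * cnj (q a j))"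
    by blast
  have M: "mat_adjoint A * A = spectral_mat n k lam q"
    using A hs by (intro eq_matI) (auto simp: spectral_mat_def h_def)
  define y where "y a l = (\<Sum>j<n. A $$ (l, j) * q a j)" for a l
  have yy: "(\<Sum>l<n. y a l * cnj (y b l)) = (if a = b then of_real (lam a) else 0)" if "a < k" "b < k" for a b
  proof -
    have "(\<Sum>l<n. y a l * cnj (y b l)) =
        (\<Sum>l<n. \<Sum>j<n. \<Sum>i<n. (A $$ (l, j) * cnj (A $$ (l, i))) * q a j * cnj (q b i))"
      by (simp add: y_def sum_product mult_ac)
    also have "\<dots> = (\<Sum>j<n. \<Sum>i<n. \<Sum>l<n. (A $$ (l, j) * cnj (A $$ (l, i))) * q a j * cnj (q b i))"
      by (subst sum.swap) (intro sum.cong refl sum.swap)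
    also have "\<dots> = (\<Sum>j<n. \<Sum>i<n. h i j * q a j * cnj (q b i))"
      by (simp add: h sum_distrib_right)
    also have "\<dots> = (\<Sum>i<n. (\<Sum>j<n. h i j * q a j) * cnj (q b i))"
      by (subst sum.swap) (simp add: sum_distrib_right)
    also have "\<dots> = (\<Sum>i<n. of_real (lam a) * q a i * cnj (q b i))"
      using spectral_mat_eigenvector[OF q that(1), of _ lam] by (simp add: h_def M)
    also have "\<dots> = of_real (lam a) * (\<Sum>i<n. q a i * cnj (q b i))"
      by (simp add: sum_distrib_left mult.assoc)
    finally show ?thesis using q that by (simp add: orthonormal_def)
  qed
  have lam_pos: "lam a > 0" if "a < k" for a
  proof -
    have "complex_of_real (lam a) = of_real (\<Sum>l<n. (cmod (y a l))\<^sup>2)"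
      using yy[OF that that] by (simp only: of_real_sum_cmod_square if_True refl)
    then have "lam a = (\<Sum>l<n. (cmod (y a l))\<^sup>2)" using of_real_eq_iff by blast
    then have "lam a \<ge> 0" by (simp add: sum_nonneg)
    then show ?thesis using lam[OF that] by simp
  qed
  define w where "w a l = y a l / of_real (sqrt (lam a))" for a l
  have ss: "complex_of_real (sqrt (lam a)) * of_real (sqrt (lam a)) = of_real (lam a)" if "a < k" for a
    using lam_pos[OF that] by (simp flip: of_real_mult)
  have "orthonormal n k w"
    unfolding orthonormal_def
  proof (intro allI impI)
    fix a b assume ab: "a < k" "b < k"
    have "(\<Sum>l<n. w a l * cnj (w b l)) = (\<Sum>l<n. y a l * cnj (y b l)) / (of_real (sqrt (lam a)) * of_real (sqrt (lam b)))"
      by (simp add: w_def sum_divide_distrib)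
    then show "(\<Sum>l<n. w a l * cnj (w b l)) = (if a = b then 1 else 0)"
      using yy[OF ab] ss[OF ab(1)] lam[OF ab(1)] by auto
  qed
  moreover have "(\<Sum>l<n. y a l * cnj (w a l)) = of_real (sqrt (lam a))" if "a < k" for a
  proof -
    have "(\<Sum>l<n. y a l * cnj (w a l)) = of_real (lam a) / of_real (sqrt (lam a))"
      using yy[OF that that] by (simp add: w_def sum_divide_distrib[symmetric])
    then show ?thesis using ss[OF that] lam_pos[OF that] by (metis nonzero_mult_div_cancel_left of_real_0 of_real_eq_iff order_less_irrefl real_sqrt_eq_zero_cancel_iff)
  qed
  moreover have "trace_norm A = (\<Sum>a<k. sqrt (lam a))"
    unfolding trace_norm_def M
    by (subst psd_sqrt_spectral_mat[OF q]) (simp_all add: spectral_mat_trace[OF q] lam_pos less_imp_le)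
  ultimately show ?thesis
    by (intro that[of k w q] q) (simp_all add: y_def sum_distrib_right)
qed

lemma rank_one_bound:
  assumes w: "orthonormal n k w" and q: "orthonormal n k q"
  shows "cmod (\<Sum>a<k. \<Sum>i<n. \<Sum>j<n. x i * y j * q a j * cnj (w a i)) \<le>
    sqrt (\<Sum>i<n. (cmod (x i))\<^sup>2) * sqrt (\<Sum>j<n. (cmod (y j))\<^sup>2)"
proof -
  define f g where "f a = (\<Sum>i<n. x i * cnj (w a i))"
    and "g a = (\<Sum>j<n. cnj (y j) * cnj (q a j))" for a
  have "(\<Sum>i<n. \<Sum>j<n. x i * y j * q a j * cnj (w a i)) = f a * cnj (g a)" for a
  proof -
    have "cnj (g a) = (\<Sum>j<n. y j * q a j)" by (simp add: g_def)
    then show ?thesis by (simp only: f_def sum_product) (simp add: mult_ac)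
  qed
  then have "cmod (\<Sum>a<k. \<Sum>i<n. \<Sum>j<n. x i * y j * q a j * cnj (w a i)) = cmod (\<Sum>a<k. f a * cnj (g a))"
    by simp
  also have "\<dots> \<le> (\<Sum>a<k. \<bar>cmod (f a)\<bar> * \<bar>cmod (g a)\<bar>)"
    by (rule order_trans[OF norm_sum]) (simp add: norm_mult)
  also have "\<dots> \<le> L2_set (\<lambda>a. cmod (f a)) {..<k} * L2_set (\<lambda>a. cmod (g a)) {..<k}"
    by (rule L2_set_mult_ineq)
  also have "\<dots> \<le> sqrt (\<Sum>i<n. (cmod (x i))\<^sup>2) * sqrt (\<Sum>j<n. (cmod (y j))\<^sup>2)"
    using bessel[OF w, of x] bessel[OF q, of "\<lambda>j. cnj (y j)"]
    unfolding L2_set_def f_def g_def by (intro mult_mono real_sqrt_le_mono) (auto intro: sum_nonneg)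
  finally show ?thesis .
qed

text \<open>Convexity of the trace norm, in the form of Jensen's inequality for averages of rank one
  matrices. A witness \<open>(w, q)\<close> of the trace norm of the average does not depend on \<open>z\<close>,
  so \<open>rank_one_bound\<close> applies pointwise under the integral. The bound \<open>C\<close> also dominates every
  single entry, whence integrability.\<close>

lemma trace_norm_integral_rank_one:
  fixes x y :: "'a \<Rightarrow> nat \<Rightarrow> complex"
  assumes M: "prob_space M" and A: "A \<in> carrier_mat n n"
    and entries: "\<And>i j. i < n \<Longrightarrow> j < n \<Longrightarrow> A $$ (i, j) = (\<integral>z. x z i * y z j \<partial>M)"
    and meas: "\<And>i. i < n \<Longrightarrow> (\<lambda>z. x z i) \<in> borel_measurable M"
      "\<And>j. j < n \<Longrightarrow> (\<lambda>z. y z j) \<in> borel_measurable M"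
    and bound: "AE z in M. sqrt (\<Sum>i<n. (cmod (x z i))\<^sup>2) * sqrt (\<Sum>j<n. (cmod (y z j))\<^sup>2) \<le> C"
  shows "trace_norm A \<le> C"
proof -
  interpret prob_space M by (rule M)
  have int: "integrable M (\<lambda>z. x z i * y z j)" if ij: "i < n" "j < n" for i j
  proof (rule integrable_const_bound[where B = C])
    show "AE z in M. cmod (x z i * y z j) \<le> C"
      using bound
    proof eventually_elim
      fix z assume C: "sqrt (\<Sum>i<n. (cmod (x z i))\<^sup>2) * sqrt (\<Sum>j<n. (cmod (y z j))\<^sup>2) \<le> C"
      have *: "cmod (t l) \<le> sqrt (\<Sum>l<n. (cmod (t l))\<^sup>2)" if "l < n" for t :: "nat \<Rightarrow> complex" and l
        by (rule real_le_rsqrt, rule member_le_sum) (use that in auto)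
      have "cmod (x z i * y z j) \<le> sqrt (\<Sum>i<n. (cmod (x z i))\<^sup>2) * sqrt (\<Sum>j<n. (cmod (y z j))\<^sup>2)"
        unfolding norm_mult by (intro mult_mono * ij) (auto intro: sum_nonneg)
      then show "cmod (x z i * y z j) \<le> C" using C by linarith
    qed
  qed (use meas ij in auto)
  obtain k w q where w: "orthonormal n k w" and q: "orthonormal n k q"
    and tr: "of_real (trace_norm A) = (\<Sum>a<k. \<Sum>i<n. \<Sum>j<n. A $$ (i, j) * q a j * cnj (w a i))"
    using trace_norm_attained[OF A] by blast
  define F where "F z = (\<Sum>a<k. \<Sum>i<n. \<Sum>j<n. x z i * y z j * q a j * cnj (w a i))" for z
  have intF: "integrable M F"
    unfolding F_def using int by (intro Bochner_Integration.integrable_sum integrable_mult_left) auto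
  have "complex_of_real (trace_norm A) = (\<integral>z. F z \<partial>M)"
    unfolding tr F_def using int
    by (subst Bochner_Integration.integral_sum; (intro Bochner_Integration.integrable_sum integrable_mult_left)?; simp add: entries)+
  then have "trace_norm A \<le> cmod (\<integral>z. F z \<partial>M)" by (metis abs_ge_self norm_of_real)
  also have "\<dots> \<le> (\<integral>z. cmod (F z) \<partial>M)" by (rule integral_norm_bound)
  also have "\<dots> \<le> C"
  proof (rule integral_le_const)
    show "AE z in M. cmod (F z) \<le> C"
      using bound
    proof eventually_elim
      fix z assume "sqrt (\<Sum>i<n. (cmod (x z i))\<^sup>2) * sqrt (\<Sum>j<n. (cmod (y z j))\<^sup>2) \<le> C"
      then show "cmod (F z) \<le> C"
        unfolding F_def by (rule order_trans[OF rank_one_bound[OF w q]])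
    qed
  qed (use intF in auto)
  finally show ?thesis .
qed

section \<open>The twirl as an average of product matrices\<close>

text \<open>As \<open>i\<close> runs through the numbers below \<open>n ^ p\<close>, its \<open>p\<close> digits run independently through the
  numbers below \<open>n\<close>; this is why norms of Kronecker products multiply.\<close>

lemma sum_prod_dig:
  fixes f :: "nat \<Rightarrow> nat \<Rightarrow> 'a :: comm_semiring_1"
  shows "(\<Sum>i<n ^ p. \<Prod>k = 1..p. f k (dig n p k i)) = (\<Prod>k = 1..p. \<Sum>c<n. f k c)"
proof (induction p)
  case (Suc p)
  have *: "(\<Prod>k = 1..Suc p. f k (dig n (Suc p) k (c + m * n))) = (\<Prod>k = 1..p. f k (dig n p k m)) * f (Suc p) c"
    if "c < n" for c m
  proof -
    have "(\<Prod>k = 1..p. f k (dig n (Suc p) k (c + m * n))) = (\<Prod>k = 1..p. f k (dig n p k m))"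
      using that by (intro prod.cong refl) (simp add: dig_Suc)
    then show ?thesis using that by (simp add: dig_last)
  qed
  have "(\<Sum>i<n ^ Suc p. \<Prod>k = 1..Suc p. f k (dig n (Suc p) k i)) =
      (\<Sum>m<n ^ p. \<Sum>i = m * n..<m * n + n. \<Prod>k = 1..Suc p. f k (dig n (Suc p) k i))"
    by (simp only: sum.nat_group power_Suc2)
  also have "\<dots> = (\<Sum>m<n ^ p. \<Sum>c<n. \<Prod>k = 1..Suc p. f k (dig n (Suc p) k (c + m * n)))"
  proof (rule sum.cong[OF refl])
    fix m
    show "(\<Sum>i = m * n..<m * n + n. \<Prod>k = 1..Suc p. f k (dig n (Suc p) k i)) =
        (\<Sum>c<n. \<Prod>k = 1..Suc p. f k (dig n (Suc p) k (c + m * n)))"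
      using sum.shift_bounds_nat_ivl[of "\<lambda>i. \<Prod>k = 1..Suc p. f k (dig n (Suc p) k i)" 0 "m * n" n]
      by (simp only: add_0 add.commute[of n] atLeast0LessThan)
  qed
  also have "\<dots> = (\<Sum>m<n ^ p. \<Sum>c<n. (\<Prod>k = 1..p. f k (dig n p k m)) * f (Suc p) c)"
    by (intro sum.cong refl *) simp
  also have "\<dots> = (\<Sum>m<n ^ p. \<Prod>k = 1..p. f k (dig n p k m)) * (\<Sum>c<n. f (Suc p) c)"
    by (simp only: sum_product)
  also have "\<dots> = (\<Prod>k = 1..Suc p. \<Sum>c<n. f k c)" unfolding Suc.IH by simp
  finally show ?case .
qed simp

lemma circle_haar_unimodular: "AE z in circle_haar. cmod z = 1"
proof -
  have "{z :: complex. cmod z = 1} \<in> sets borel" by measurable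
  then show ?thesis unfolding circle_haar_def by (subst AE_distr_iff) auto
qed

lemma torus_haar_unimodular: "AE z in torus_haar n. \<forall>c<n. cmod (z c) = 1"
proof -
  have "AE z in torus_haar n. cmod (z c) = 1" if "c \<in> {..<n}" for c
    unfolding torus_haar_def
    by (rule AE_PiM_component[OF prob_space_circle_haar that circle_haar_unimodular])
  then have "AE z in torus_haar n. \<forall>c\<in>{..<n}. cmod (z c) = 1"
    by (intro AE_finite_allI) auto
  then show ?thesis by (rule eventually_mono) simp
qed

lemma realign_eq_entries:
  assumes "\<sigma> permutes {1..2 * p}" and "X \<in> carrier_mat (n ^ p) (n ^ p)"
  shows "realign n p \<sigma> X = realign_entries n p \<sigma> X"
  using is_realignment_unique[OF assms(1) realign_is_realignment[OF assms(1)] is_realignment_entries[OF assms(1)] assms(2)]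
    assms(2) by simp

text \<open>The \<open>2p\<close> vectors in the description of a realignment map, for the product of the
  \<open>U v\<^sub>k (U v\<^sub>k)\<^sup>*\<close>, where \<open>U\<close> is the diagonal matrix of \<open>z\<close>: first the \<open>U v\<^sub>k\<close>, then their
  conjugates.\<close>

definition rotated ::
  "nat \<Rightarrow> nat \<Rightarrow> (nat \<Rightarrow> complex Matrix.vec) \<Rightarrow> (nat \<Rightarrow> complex) \<Rightarrow> nat \<Rightarrow> complex Matrix.vec" where
  "rotated n p v z m =
     Matrix.vec n (\<lambda>c. if m \<le> p then z c * v m $ c else cnj (z c * v (m - p) $ c))"

lemma rotated_carrier: "rotated n p v z m \<in> carrier_vec n"
  by (simp add: rotated_def)

text \<open>Conjugation by \<open>U \<otimes> \<dots> \<otimes> U\<close> acts on each tensor factor separately. This Kronecker power is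
  diagonal too, so the effect can be read off entry by entry.\<close>

lemma conjugate_by_diagonal:
  assumes v: "\<forall>k \<in> {1..p}. v k \<in> carrier_vec n"
  defines "X \<equiv> kron_prod p (\<lambda>k. outer (v k) (conjugate (v k)))"
    and "W z \<equiv> kron_prod p (\<lambda>_. mat_diag n z)"
  shows "W z * X * mat_adjoint (W z) =
    kron_prod p (\<lambda>k. outer (rotated n p v z k) (rotated n p v z (p + k)))" (is "_ = ?Y")
proof -
  let ?N = "n ^ p"
  have oX: "outer (v k) (conjugate (v k)) \<in> carrier_mat n n" if "k \<in> {1..p}" for k
    using v that by (intro outer_carrier) auto
  have oY: "outer (rotated n p v z k) (rotated n p v z (p + k)) \<in> carrier_mat n n" for k
    by (intro outer_carrier rotated_carrier)
  have cX: "X \<in> carrier_mat ?N ?N" unfolding X_def by (rule kron_prod_carrier) (rule oX)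
  have cW: "W z \<in> carrier_mat ?N ?N" unfolding W_def by (rule kron_prod_carrier) simp
  have cY: "?Y \<in> carrier_mat ?N ?N" by (rule kron_prod_carrier) (rule oY)
  define d where "d i = (\<Prod>k = 1..p. z (dig n p k i))" for i
  have Wij: "W z $$ (i, j) = (if i = j then d i else 0)" if ij: "i < ?N" "j < ?N" for i j
  proof (cases "i = j")
    case True
    have "W z $$ (i, j) = (\<Prod>k = 1..p. mat_diag n z $$ (dig n p k i, dig n p k j))"
      unfolding W_def by (rule kron_prod_index[OF _ ij]) simp
    also have "\<dots> = d i"
      unfolding d_def True using dig_less[OF ij(2)] by (intro prod.cong refl) (simp add: mat_diag_def)
    finally show ?thesis using True by simp
  next
    case False
    then obtain l where l: "l \<in> {1..p}" "dig n p l i \<noteq> dig n p l j" using dig_inj[OF ij] by blast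
    have "W z $$ (i, j) = (\<Prod>k = 1..p. mat_diag n z $$ (dig n p k i, dig n p k j))"
      unfolding W_def by (rule kron_prod_index[OF _ ij]) simp
    also have "\<dots> = 0"
      using l dig_less[OF ij(1)] dig_less[OF ij(2)]
      by (intro prod_zero bexI[of _ l]) (auto simp: mat_diag_def)
    finally show ?thesis using False by simp
  qed
  show ?thesis
  proof (rule eq_matI)
    fix i j assume "i < dim_row ?Y" "j < dim_col ?Y"
    then have ij: "i < ?N" "j < ?N" using cY by auto
    have WX: "(W z * X) $$ (i, l) = d i * X $$ (i, l)" if l: "l < ?N" for l
    proof -
      have "(W z * X) $$ (i, l) = (\<Sum>m<?N. W z $$ (i, m) * X $$ (m, l))"
        using cW cX ij l by (simp add: scalar_prod_def lessThan_atLeast0)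
      also have "\<dots> = (\<Sum>m<?N. if m = i then d i * X $$ (i, l) else 0)"
        using ij by (intro sum.cong refl) (auto simp: Wij)
      finally show ?thesis using ij by simp
    qed
    have "(W z * X * mat_adjoint (W z)) $$ (i, j) =
        (\<Sum>m<?N. (W z * X) $$ (i, m) * mat_adjoint (W z) $$ (m, j))"
      using cW cX ij by (simp add: scalar_prod_def lessThan_atLeast0)
    also have "\<dots> = (\<Sum>m<?N. if m = j then d i * X $$ (i, j) * cnj (d j) else 0)"
      using ij cW by (intro sum.cong refl) (auto simp: WX Wij mat_adjoint_index)
    also have "\<dots> = d i * X $$ (i, j) * cnj (d j)" using ij by simp
    also have "X $$ (i, j) = (\<Prod>k = 1..p. outer (v k) (conjugate (v k)) $$ (dig n p k i, dig n p k j))"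
      unfolding X_def by (rule kron_prod_index[OF oX ij])
    also have "d i * \<dots> * cnj (d j) =
        (\<Prod>k = 1..p. z (dig n p k i) * outer (v k) (conjugate (v k)) $$ (dig n p k i, dig n p k j) * cnj (z (dig n p k j)))"
      by (simp add: d_def prod.distrib)
    also have "\<dots> = (\<Prod>k = 1..p. outer (rotated n p v z k) (rotated n p v z (p + k)) $$ (dig n p k i, dig n p k j))"
    proof (rule prod.cong[OF refl])
      fix k assume k: "k \<in> {1..p}"
      then have "dim_vec (v k) = n" using v by auto
      then show "z (dig n p k i) * outer (v k) (conjugate (v k)) $$ (dig n p k i, dig n p k j) * cnj (z (dig n p k j)) =
          outer (rotated n p v z k) (rotated n p v z (p + k)) $$ (dig n p k i, dig n p k j)"
        using k dig_less[OF ij(1) k] dig_less[OF ij(2) k] by (simp add: outer_def rotated_def)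
    qed
    also have "\<dots> = ?Y $$ (i, j)" by (rule kron_prod_index[OF oY ij, symmetric])
    finally show "(W z * X * mat_adjoint (W z)) $$ (i, j) = ?Y $$ (i, j)" .
  qed (use cX cW cY in auto)
qed

text \<open>The entry at \<open>i\<close> of the vector \<open>u\<^sub>1 \<otimes> \<dots> \<otimes> u\<^sub>p\<close>.\<close>

definition kron_vec :: "nat \<Rightarrow> nat \<Rightarrow> (nat \<Rightarrow> complex Matrix.vec) \<Rightarrow> nat \<Rightarrow> complex" where
  "kron_vec n p u i = (\<Prod>k = 1..p. u k $ dig n p k i)"

lemma kron_vec_norm:
  assumes "\<And>k. k \<in> {1..p} \<Longrightarrow> u k \<in> carrier_vec n"
  shows "sqrt (\<Sum>i<n ^ p. (cmod (kron_vec n p u i))\<^sup>2) = (\<Prod>k = 1..p. vec_norm2 (u k))"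
proof -
  have "(\<Sum>i<n ^ p. (cmod (kron_vec n p u i))\<^sup>2) =
      (\<Sum>i<n ^ p. \<Prod>k = 1..p. (cmod (u k $ dig n p k i))\<^sup>2)"
    by (simp add: kron_vec_def prod_norm[symmetric] prod_power_distrib)
  also have "\<dots> = (\<Prod>k = 1..p. \<Sum>c<n. (cmod (u k $ c))\<^sup>2)" by (rule sum_prod_dig)
  also have "sqrt \<dots> = (\<Prod>k = 1..p. sqrt (\<Sum>c<n. (cmod (u k $ c))\<^sup>2))"
    by (induction p) (simp_all add: real_sqrt_mult)
  also have "\<dots> = (\<Prod>k = 1..p. vec_norm2 (u k))"
    using carrier_vecD[OF assms] by (intro prod.cong refl) (simp add: vec_norm2_def)
  finally show ?thesis .
qed

text \<open>The Kronecker product of rank one matrices is the rank one matrix of the Kronecker products.\<close>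

lemma kron_prod_outer_index:
  assumes "\<And>k. k \<in> {1..p} \<Longrightarrow> u k \<in> carrier_vec n" "\<And>k. k \<in> {1..p} \<Longrightarrow> w k \<in> carrier_vec n"
    and ij: "i < n ^ p" "j < n ^ p"
  shows "kron_prod p (\<lambda>k. outer (u k) (w k)) $$ (i, j) = kron_vec n p u i * kron_vec n p w j"
proof -
  have "kron_prod p (\<lambda>k. outer (u k) (w k)) $$ (i, j) =
      (\<Prod>k = 1..p. outer (u k) (w k) $$ (dig n p k i, dig n p k j))"
    by (rule kron_prod_index[OF _ ij]) (intro outer_carrier assms)
  also have "\<dots> = (\<Prod>k = 1..p. u k $ dig n p k i * w k $ dig n p k j)"
  proof (rule prod.cong[OF refl])
    fix k assume k: "k \<in> {1..p}"
    then show "outer (u k) (w k) $$ (dig n p k i, dig n p k j) = u k $ dig n p k i * w k $ dig n p k j"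
      using assms(1,2)[OF k] dig_less[OF ij(1) k] dig_less[OF ij(2) k] by (auto simp: outer_def)
  qed
  finally show ?thesis by (simp add: kron_vec_def prod.distrib)
qed

text \<open>Realignment only moves entries around, and the twirl is an entrywise integral, so the two
  commute; under the integral, realignment acts on a product and merely permutes its vectors.\<close>

lemma realign_twirl_index:
  assumes v: "\<forall>k \<in> {1..p}. v k \<in> carrier_vec n" and \<sigma>: "\<sigma> permutes {1..2 * p}"
    and ij: "i < n ^ p" "j < n ^ p"
  shows "realign n p \<sigma> (twirl n p (kron_prod p (\<lambda>k. outer (v k) (conjugate (v k))))) $$ (i, j) =
    (\<integral>z. kron_vec n p (\<lambda>k. rotated n p v z (\<sigma> k)) i *
         kron_vec n p (\<lambda>k. rotated n p v z (\<sigma> (p + k))) j \<partial>torus_haar n)"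
proof -
  let ?X = "kron_prod p (\<lambda>k. outer (v k) (conjugate (v k)))"
  let ?Y = "\<lambda>z. kron_prod p (\<lambda>k. outer (rotated n p v z k) (rotated n p v z (p + k)))"
  let ?inv = "inv_into UNIV \<sigma>"
  have inv: "?inv permutes {1..2 * p}" using \<sigma> by (rule permutes_inv)
  define i' j' where "i' = enc n p (\<lambda>k. multi_index n p i j (?inv k))"
    and "j' = enc n p (\<lambda>k. multi_index n p i j (?inv (p + k)))"
  have lt: "i' < n ^ p" "j' < n ^ p"
    unfolding i'_def j'_def
    by (auto intro!: enc_less multi_index_less[OF ij] permutes_double[OF inv])
  have Y: "?Y z \<in> carrier_mat (n ^ p) (n ^ p)" for z
    by (intro kron_prod_carrier outer_carrier rotated_carrier)
  have "realign n p \<sigma> (twirl n p ?X) $$ (i, j) = twirl n p ?X $$ (i', j')"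
    using ij by (subst realign_eq_entries[OF \<sigma>]) (simp_all add: twirl_def realign_entries_def i'_def j'_def)
  also have "\<dots> = (\<integral>z. ?Y z $$ (i', j') \<partial>torus_haar n)"
    using lt by (simp add: twirl_def Let_def conjugate_by_diagonal[OF v])
  also have "\<dots> = (\<integral>z. realign n p \<sigma> (?Y z) $$ (i, j) \<partial>torus_haar n)"
    using ij by (simp add: realign_eq_entries[OF \<sigma> Y] realign_entries_def i'_def j'_def)
  also have "\<dots> = (\<integral>z. kron_prod p (\<lambda>k. outer (rotated n p v z (\<sigma> k)) (rotated n p v z (\<sigma> (p + k)))) $$ (i, j)
      \<partial>torus_haar n)"
  proof -
    have "realign n p \<sigma> (?Y z) =
        kron_prod p (\<lambda>k. outer (rotated n p v z (\<sigma> k)) (rotated n p v z (\<sigma> (p + k))))" for z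
      using realign_is_realignment[OF \<sigma>, of n] unfolding is_realignment_def
      using rotated_carrier by blast
    then show ?thesis by simp
  qed
  also have "\<dots> = (\<integral>z. kron_vec n p (\<lambda>k. rotated n p v z (\<sigma> k)) i *
         kron_vec n p (\<lambda>k. rotated n p v z (\<sigma> (p + k))) j \<partial>torus_haar n)"
    by (simp only: kron_prod_outer_index[OF rotated_carrier rotated_carrier ij])
  finally show ?thesis .
qed

lemma rotated_norm:
  assumes "\<forall>c<n. cmod (z c) = 1" and "v k \<in> carrier_vec n" and "k \<in> {1..p}"
  shows "vec_norm2 (rotated n p v z k) = vec_norm2 (v k)"
    and "vec_norm2 (rotated n p v z (p + k)) = vec_norm2 (v k)"
  using assms by (auto simp: vec_norm2_def rotated_def norm_mult)

lemma kron_vec_rotated_measurable: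
  assumes "i < n ^ p"
  shows "(\<lambda>z. kron_vec n p (\<lambda>k. rotated n p v z (\<tau> k)) i) \<in> borel_measurable (torus_haar n)"
proof -
  have z: "(\<lambda>z. z c) \<in> borel_measurable (torus_haar n)" if "c < n" for c
    using measurable_component_singleton[of c "{..<n}" "\<lambda>_. circle_haar"] that
    by (simp add: torus_haar_def)
  have cnj: "cnj \<in> borel_measurable borel"
    by (intro borel_measurable_continuous_onI continuous_intros)
  have "(\<lambda>z. rotated n p v z m $ c) \<in> borel_measurable (torus_haar n)" if "c < n" for c m
    using that z[OF that] measurable_compose[OF z[OF that] cnj]
    by (cases "m \<le> p") (auto simp: rotated_def)
  then show ?thesis
    unfolding kron_vec_def using dig_less[OF assms] by (intro borel_measurable_prod) auto
qed

theorem theorem4p1: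
  fixes n p :: nat
    and v :: "nat \<Rightarrow> complex Matrix.vec"
    and \<sigma> :: "nat \<Rightarrow> nat"
  assumes "p \<ge> 2"
    and "\<forall>j \<in> {1..p}. v j \<in> carrier_vec n"
    and "\<sigma> permutes {1..2 * p}"
  shows "trace_norm (realign n p \<sigma> (twirl n p (kron_prod p (\<lambda>j. outer (v j) (conjugate (v j))))))
    \<le> (\<Prod>j = 1..p. (vec_norm2 (v j))\<^sup>2)"
proof (rule trace_norm_integral_rank_one[OF prob_space_torus_haar, where n = "n ^ p"])
  let ?x = "\<lambda>z. kron_vec n p (\<lambda>k. rotated n p v z (\<sigma> k))"
  let ?y = "\<lambda>z. kron_vec n p (\<lambda>k. rotated n p v z (\<sigma> (p + k)))"
  show "realign n p \<sigma> (twirl n p (kron_prod p (\<lambda>j. outer (v j) (conjugate (v j))))) \<in> carrier_mat (n ^ p) (n ^ p)"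
    by (subst realign_eq_entries[OF assms(3)]) (simp_all add: twirl_def realign_entries_def)
  show "realign n p \<sigma> (twirl n p (kron_prod p (\<lambda>j. outer (v j) (conjugate (v j))))) $$ (i, j) =
      (\<integral>z. ?x z i * ?y z j \<partial>torus_haar n)" if "i < n ^ p" "j < n ^ p" for i j
    by (rule realign_twirl_index[OF assms(2,3) that])
  show "AE z in torus_haar n. sqrt (\<Sum>i<n ^ p. (cmod (?x z i))\<^sup>2) * sqrt (\<Sum>j<n ^ p. (cmod (?y z j))\<^sup>2)
      \<le> (\<Prod>j = 1..p. (vec_norm2 (v j))\<^sup>2)"
    using torus_haar_unimodular
  proof eventually_elim
    fix z :: "nat \<Rightarrow> complex" assume z: "\<forall>c<n. cmod (z c) = 1"
    \<comment> \<open>The norms are embedded into the complex numbers, where \<open>prod_split2\<close> splits the product.\<close>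
    define N where "N m = complex_of_real (vec_norm2 (rotated n p v z m))" for m
    have "complex_of_real (sqrt (\<Sum>i<n ^ p. (cmod (?x z i))\<^sup>2) * sqrt (\<Sum>j<n ^ p. (cmod (?y z j))\<^sup>2)) =
        (\<Prod>k = 1..p. N (\<sigma> k) * N (\<sigma> (p + k)))"
      by (simp add: kron_vec_norm[OF rotated_carrier] N_def prod.distrib)
    also have "\<dots> = (\<Prod>m = 1..2 * p. N (\<sigma> m))" by (rule prod_split2[symmetric])
    also have "\<dots> = (\<Prod>m = 1..2 * p. N m)" using prod.permute[OF assms(3), of N] by (simp add: o_def)
    also have "\<dots> = (\<Prod>k = 1..p. N k * N (p + k))" by (rule prod_split2)
    also have "\<dots> = complex_of_real (\<Prod>j = 1..p. (vec_norm2 (v j))\<^sup>2)"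
      unfolding of_real_prod using assms(2) rotated_norm[OF z]
      by (intro prod.cong refl) (simp add: N_def power2_eq_square)
    finally show "sqrt (\<Sum>i<n ^ p. (cmod (?x z i))\<^sup>2) * sqrt (\<Sum>j<n ^ p. (cmod (?y z j))\<^sup>2)
        \<le> (\<Prod>j = 1..p. (vec_norm2 (v j))\<^sup>2)"
      using of_real_eq_iff by (metis order_refl)
  qed
qed (auto intro: kron_vec_rotated_measurable)

end
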